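(* Let $f:X\to Y$ be a continuous map between Banach spaces and let $Jf$ be a pseudo-Jacobian mapping for $f$ on $X$ satisfying the chain rule condition on $X$. Suppose that $Jf$ is regular at every $x\in X$ and satisfies the Hadamard integral condition $$\int_0^\infty\inf_{\|x\|\le t}\alpha_{Jf}(x)\,dt=\infty.$$ Then $f$ is a global homeomorphism from $X$ onto $Y$, whose inverse is Lipschitz on each bounded subset of $Y$. Furthermore, for each $x_0\in X$ and each $\delta>0$, $$B\bigl(f(x_0),\rho\bigr)\subset f\bigl(B(x_0,\delta)\bigr),\quad\text{where}\quad\rho=\int_0^\delta\inf_{\|x-x_0\|\le t}\alpha_{Jf}(x)\,dt.$$
   Context: Banach spaces are real; $\mathcal{L}(X,Y)$ is the space of bounded linear operators from $X$ to $Y$; $B(x,r)$ denotes the open ball; $\mathrm{co}$ denotes convex hull. For $\varphi:U\to\mathbb{R}$ with $U\subset X$ open, $x\in U$ and $v\in X$, $\varphi'_{+}(x;v)=\limsup_{t\to0^+}\frac{\varphi(x+tv)-\varphi(x)}{t}$. For a map $f:U\to Y$ and $x\in U$, a nonempty set $Jf(x)\subset\mathcal{L}(X,Y)$ is a pseudo-Jacobian of $f$ at $x$ if $(y^*\circ f)'_{+}(x;v)\le\sup\{\langle y^*,T(v)\rangle : T\in Jf(x)\}$ for all $y^*\in Y^*$ and $v\in X$. (For real-valued functions, pseudo-Jacobians are subsets of $X^*$.) A set-valued mapping $Jf:U\to2^{\mathcal{L}(X,Y)}$ is a pseudo-Jacobian mapping for $f$ on $U$ if $Jf(x)$ is a pseudo-Jacobian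 of $f$ at $x$ for every $x\in U$. For $A\subset U$, $Jf(A)=\{T : T\in Jf(z),\ z\in A\}$. Chain rule condition: for $y\in Y$ let $d_y(v)=\|v-y\|$, $v\in Y$, and let $\partial d_y(v)$ be its Clarke subdifferential (which, $d_y$ being convex and Lipschitz, is the convex subdifferential $\{y^*\in Y^* : \|w-y\|\ge\|v-y\|+\langle y^*,w-v\rangle\ \forall w\in Y\}$). For $x\in U$, $y\in Y$, $y\ne f(x)$, let $A_{x,y}(f)=\{y^*\circ T : y^*\in\partial d_y(f(x)),\ T\in\overline{\mathrm{co}}(Jf(x))\}\subset X^*$, where $\overline{\mathrm{co}}$ is the operator-norm closed convex hull. $Jf$ satisfies the chain rule condition on $U$ if for each $x\in U$ and each $y\in Y$ with $y\neq f(x)$, the set $A_{x,y}(f)$ is a $w^*$-closed and convex pseudo-Jacobian of $d_y\circ f$ at $x$. Regularity: for $T\in\mathcal{L}(X,Y)$ put $c(T)=\inf_{\|x\|=1}\|Tx\|$ (co-norm). The regularity index of $Jf$ at $x$ is $\alpha_{Jf}(x)=\sup_{r>0}\inf\{c(T) : T\in\mathrm{co}\,Jf(B(x,r))\}$ (over $r$ with $B(x,r)\subset U$). $Jf$ is regular at $x$ if for some $r>0$ every $T\in\mathrm{co}\,Jf(B(x,r))$ is an isomorphism (bounded linear bijection from $X$ onto $Y$ with bounded inverse) and $\alpha_{Jf}(x)>0$. *)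

theory Defs
  imports "HOL-Analysis.Analysis"
begin

text \<open>
  One-sided directional limits, suprema over sets of operators, co-norms and regularity indices
  are taken in the extended reals or the extended nonnegative reals, so that no boundedness side
  conditions are needed.
\<close>

definition upper_dini :: "('a::real_normed_vector \<Rightarrow> real) \<Rightarrow> 'a \<Rightarrow> 'a \<Rightarrow> ereal" where
  "upper_dini \<phi> x v = Limsup (at_right 0) (\<lambda>t. ereal ((\<phi> (x + t *\<^sub>R v) - \<phi> x) / t))"

text \<open>For real-valued \<open>f\<close> (that is, \<open>'b = real\<close>) a pseudo-Jacobian is a subset of the dual
  \<open>'a \<Rightarrow>\<^sub>L real\<close>.\<close>

definition is_pseudo_jacobian ::
    "('a::real_normed_vector \<Rightarrow> 'b::real_normed_vector) \<Rightarrow> 'a \<Rightarrow> ('a \<Rightarrow>\<^sub>L 'b) set \<Rightarrow> bool" where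
  "is_pseudo_jacobian f x J \<longleftrightarrow>
     J \<noteq> {} \<and>
     (\<forall>(p :: 'b \<Rightarrow>\<^sub>L real) v.
        upper_dini (\<lambda>z. blinfun_apply p (f z)) x v
          \<le> (SUP T\<in>J. ereal (blinfun_apply p (blinfun_apply T v))))"

definition pseudo_jacobian_mapping ::
    "'a::real_normed_vector set \<Rightarrow> ('a \<Rightarrow> 'b::real_normed_vector) \<Rightarrow> ('a \<Rightarrow> ('a \<Rightarrow>\<^sub>L 'b) set) \<Rightarrow> bool"
  where
  "pseudo_jacobian_mapping U f Jf \<longleftrightarrow> (\<forall>x\<in>U. is_pseudo_jacobian f x (Jf x))"

definition clarke_derivative :: "('a::real_normed_vector \<Rightarrow> real) \<Rightarrow> 'a \<Rightarrow> 'a \<Rightarrow> ereal" where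
  "clarke_derivative \<phi> x v =
     Limsup (nhds x \<times>\<^sub>F at_right 0) (\<lambda>(z, t). ereal ((\<phi> (z + t *\<^sub>R v) - \<phi> z) / t))"

definition clarke_subdifferential ::
    "('a::real_normed_vector \<Rightarrow> real) \<Rightarrow> 'a \<Rightarrow> ('a \<Rightarrow>\<^sub>L real) set" where
  "clarke_subdifferential \<phi> x =
     {p. \<forall>v. ereal (blinfun_apply p v) \<le> clarke_derivative \<phi> x v}"

definition dist_fun :: "'b::real_normed_vector \<Rightarrow> 'b \<Rightarrow> real" where
  "dist_fun y v = norm (v - y)"

text \<open>Since \<open>dist_fun y\<close> is convex and Lipschitz, its Clarke subdifferential is its convex
  subdifferential.\<close>

lemma clarke_subdifferential_dist_fun:
  fixes y v :: "'b::real_normed_vector"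
  shows "clarke_subdifferential (dist_fun y) v =
    {p. \<forall>w. dist_fun y w \<ge> dist_fun y v + blinfun_apply p (w - v)}"
proof (intro set_eqI iffI)
  fix p assume p: "p \<in> clarke_subdifferential (dist_fun y) v"
  have "dist_fun y v + blinfun_apply p (w - v) \<le> dist_fun y w" for w
  proof -
    let ?F = "nhds v \<times>\<^sub>F at_right (0::real)"
    let ?h = "\<lambda>(z, t::real). ereal (norm (z - v) + norm (w - y) - norm (z - y))"
    have quot: "(dist_fun y (z + t *\<^sub>R (w - v)) - dist_fun y z) / t
        \<le> norm (z - v) + norm (w - y) - norm (z - y)" if t: "0 < t" "t < 1" for z t
    proof -
      have "z + t *\<^sub>R (w - v) - y = (1 - t) *\<^sub>R (z - y) + t *\<^sub>R ((z - v) + (w - y))"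
        by (simp add: algebra_simps)
      also have "norm \<dots> \<le> (1 - t) * norm (z - y) + t * norm ((z - v) + (w - y))"
        using t norm_triangle_ineq[of "(1 - t) *\<^sub>R (z - y)" "t *\<^sub>R ((z - v) + (w - y))"]
        by simp
      also have "\<dots> \<le> (1 - t) * norm (z - y) + t * (norm (z - v) + norm (w - y))"
        using t by (intro add_left_mono mult_left_mono norm_triangle_ineq) auto
      finally have "dist_fun y (z + t *\<^sub>R (w - v)) - dist_fun y z
          \<le> t * (norm (z - v) + norm (w - y) - norm (z - y))"
        by (simp add: dist_fun_def algebra_simps)
      then show ?thesis
        using t by (simp add: pos_divide_le_eq mult.commute)
    qed
    have ev: "eventually (\<lambda>t::real. 0 < t \<and> t < 1) (at_right 0)"
      using eventually_at_right[of "0::real" 1] by (auto intro!: exI[of _ 1])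
    have "eventually (\<lambda>zt. 0 < snd zt \<and> snd zt < 1) ?F"
      using filterlim_snd ev unfolding filterlim_iff by blast
    then have le: "clarke_derivative (dist_fun y) v (w - v) \<le> Limsup ?F ?h"
      unfolding clarke_derivative_def
      by (intro Limsup_mono) (auto elim!: eventually_mono intro!: quot)
    have fst: "filterlim fst (nhds v) ?F" by (rule filterlim_fst)
    have "((\<lambda>zt. norm (fst zt - v) + norm (w - y) - norm (fst zt - y))
         \<longlongrightarrow> norm (v - v) + norm (w - y) - norm (v - y)) ?F"
      using fst by (intro tendsto_intros)
    then have lim: "(?h \<longlongrightarrow> ereal (norm (w - y) - norm (v - y))) ?F"
      unfolding case_prod_unfold by (auto dest: tendsto_ereal)
    have "?F \<noteq> bot"
      by (simp add: prod_filter_eq_bot)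
    from lim_imp_Limsup[OF this lim]
    have "Limsup ?F ?h = ereal (norm (w - y) - norm (v - y))" .
    moreover have "ereal (blinfun_apply p (w - v)) \<le> clarke_derivative (dist_fun y) v (w - v)"
      using p by (simp add: clarke_subdifferential_def)
    ultimately have "ereal (blinfun_apply p (w - v)) \<le> ereal (norm (w - y) - norm (v - y))"
      using le by (metis order_trans)
    then show ?thesis by (simp add: dist_fun_def)
  qed
  then show "p \<in> {p. \<forall>w. dist_fun y w \<ge> dist_fun y v + blinfun_apply p (w - v)}" by simp
next
  fix p assume p: "p \<in> {p. \<forall>w. dist_fun y w \<ge> dist_fun y v + blinfun_apply p (w - v)}"
  have quot: "blinfun_apply p u \<le> (dist_fun y (v + t *\<^sub>R u) - dist_fun y v) / t"
    if "0 < t" for t :: real and u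
    using p[simplified, rule_format, of "v + t *\<^sub>R u"] that
    by (simp add: blinfun.scaleR_right pos_le_divide_eq mult.commute)
  have "ereal (blinfun_apply p u) \<le> clarke_derivative (dist_fun y) v u" for u
    unfolding clarke_derivative_def Limsup_def
  proof (rule INF_greatest)
    fix P assume "P \<in> {P. eventually P (nhds v \<times>\<^sub>F at_right (0::real))}"
    then obtain Q R where Q: "eventually Q (nhds v)" and R: "eventually R (at_right (0::real))"
      and QR: "\<And>z t. Q z \<Longrightarrow> R t \<Longrightarrow> P (z, t)"
      by (auto simp: eventually_prod_filter)
    have "eventually (\<lambda>t. R t \<and> 0 < t) (at_right (0::real))"
      using R eventually_at_right_less by (rule eventually_conj)
    then obtain t where t: "R t" "0 < t"
      using eventually_happens'[OF trivial_limit_at_right_real] by blast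
    have "P (v, t)" using QR eventually_nhds_x_imp_x[OF Q] t by blast
    then show "ereal (blinfun_apply p u) \<le>
      (SUP zt\<in>Collect P. case zt of (z, t) \<Rightarrow> ereal ((dist_fun y (z + t *\<^sub>R u) - dist_fun y z) / t))"
      using quot[OF t(2)] by (intro SUP_upper2[of "(v, t)"]) auto
  qed
  then show "p \<in> clarke_subdifferential (dist_fun y) v"
    by (simp add: clarke_subdifferential_def)
qed

text \<open>The closure below is taken in the operator norm.\<close>

definition chain_set ::
    "('a::real_normed_vector \<Rightarrow> 'b::real_normed_vector) \<Rightarrow> ('a \<Rightarrow> ('a \<Rightarrow>\<^sub>L 'b) set) \<Rightarrow> 'a \<Rightarrow> 'b
       \<Rightarrow> ('a \<Rightarrow>\<^sub>L real) set" where
  "chain_set f Jf x y =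
     {p o\<^sub>L T | p T. p \<in> clarke_subdifferential (dist_fun y) (f x)
                  \<and> T \<in> closure (convex hull (Jf x))}"

text \<open>On \<open>'a \<Rightarrow>\<^sub>L real\<close> the strong operator topology is the topology of pointwise convergence,
  that is, the weak-star topology of the dual.\<close>

definition chain_rule_condition ::
    "'a::real_normed_vector set \<Rightarrow> ('a \<Rightarrow> 'b::real_normed_vector) \<Rightarrow> ('a \<Rightarrow> ('a \<Rightarrow>\<^sub>L 'b) set) \<Rightarrow> bool"
  where
  "chain_rule_condition U f Jf \<longleftrightarrow>
     (\<forall>x\<in>U. \<forall>y. y \<noteq> f x \<longrightarrow>
        closedin strong_operator_topology (chain_set f Jf x y) \<and>
        convex (chain_set f Jf x y) \<and>
        is_pseudo_jacobian (dist_fun y \<circ> f) x (chain_set f Jf x y))"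

text \<open>If \<open>'a\<close> is the zero space, the infimum is over the empty set and the co-norm is \<open>\<infinity>\<close>.\<close>

definition co_norm :: "('a::real_normed_vector \<Rightarrow>\<^sub>L 'b::real_normed_vector) \<Rightarrow> ennreal" where
  "co_norm T = (INF x\<in>{x. norm x = 1}. ennreal (norm (blinfun_apply T x)))"

definition regularity_index ::
    "'a::real_normed_vector set \<Rightarrow> ('a \<Rightarrow> ('a \<Rightarrow>\<^sub>L 'b::real_normed_vector) set) \<Rightarrow> 'a \<Rightarrow> ennreal"
  where
  "regularity_index U Jf x =
     (SUP r\<in>{r. 0 < r \<and> ball x r \<subseteq> U}. INF T\<in>convex hull (\<Union>z\<in>ball x r. Jf z). co_norm T)"

definition is_isomorphism :: "('a::real_normed_vector \<Rightarrow>\<^sub>L 'b::real_normed_vector) \<Rightarrow> bool" where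
  "is_isomorphism T \<longleftrightarrow> bij (blinfun_apply T) \<and> bounded_linear (inv (blinfun_apply T))"

definition regular_at ::
    "'a::real_normed_vector set \<Rightarrow> ('a \<Rightarrow> ('a \<Rightarrow>\<^sub>L 'b::real_normed_vector) set) \<Rightarrow> 'a \<Rightarrow> bool" where
  "regular_at U Jf x \<longleftrightarrow>
     (\<exists>r>0. ball x r \<subseteq> U \<and> (\<forall>T\<in>convex hull (\<Union>z\<in>ball x r. Jf z). is_isomorphism T)) \<and>
     0 < regularity_index U Jf x"

text \<open>Open ball with a radius that is allowed to be infinite.\<close>

definition ext_ball :: "'b::metric_space \<Rightarrow> ennreal \<Rightarrow> 'b set" where
  "ext_ball y \<rho> = {z. ennreal (dist y z) < \<rho>}"

end

theory Submission
  imports Defs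
begin

text \<open>
  Regularity does two separate jobs at each point, and the Hadamard condition turns the resulting
  local information into global information.

  \<^item> \<^emph>\<open>Expansion.\<close>  On a ball \<open>B\<close> where every \<open>T\<close> in the convex hull of \<open>Jf(B)\<close> has co-norm
    at least \<open>a\<close>, the vectors \<open>T (v - u)\<close> form a convex set all of whose elements have norm at least
    \<open>a \<parallel>v - u\<parallel>\<close>.  By Hahn--Banach a single functional of norm at most one is at least
    \<open>a \<parallel>v - u\<parallel>\<close> on this set, and a mean value inequality along the segment from \<open>u\<close> to \<open>v\<close>
    carries the bound over to \<open>f v - f u\<close> (\<open>pseudo_jacobian_expansion\<close>).

  \<^item> \<^emph>\<open>Openness.\<close>  If \<open>y \<noteq> f x\<close>, every functional in the set given by the chain rule condition has
    norm at least \<open>a\<close>, since subgradients of the distance to \<open>y\<close> at other points have norm at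
    least one and the operators are onto.  That set is convex and weak-star closed, the
    dual balls are weak-star compact, and so a \<^emph>\<open>vector\<close> of the domain separates it from a dual ball of
    radius below \<open>a\<close> (\<open>weak_star_separation_from_ball\<close>).  The opposite of this vector is a direction in which the distance of \<open>f\<close> to \<open>y\<close> decreases at a definite rate, and Ekeland's
    variational principle produces a zero of that distance nearby
    (\<open>descent_implies_open_covering\<close>).

  Hence \<open>f\<close> is an open map that near each \<open>x\<close> expands distances by every factor below the
  regularity index \<open>\<alpha>(x)\<close>.  Segments in the codomain are then lifted.  A lift \<open>c\<close> of a segment with
  velocity \<open>v\<close> moves with speed at most \<open>\<parallel>v\<parallel> / \<alpha>(c(t))\<close>, and \<open>\<alpha>(c(t))\<close> is at least the
  infimum of \<open>\<alpha>\<close> on the ball about \<open>x0 = c(0)\<close> with radius \<open>\<parallel>c(t) - x0\<parallel>\<close>, so that the radial integral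
  up to \<open>\<parallel>c(t) - x0\<parallel>\<close> is at most \<open>t \<parallel>v\<parallel>\<close> (\<open>lift_radial_bound\<close>).  When the radial integral
  diverges, lifts stay in a fixed ball, where \<open>\<alpha>\<close> is bounded away from zero; they are Lipschitz,
  they extend to \<open>[0, 1]\<close>, and they depend continuously on the segment.  Mapping \<open>y\<close> to the endpoint
  of the lift of the segment from \<open>f x0\<close> to \<open>y\<close> is therefore a continuous right inverse of \<open>f\<close>.  Its
  range is open because \<open>f\<close> is locally injective and closed because it consists of the fixed points of
  a continuous map, so it is the whole connected space and the right inverse is a two-sided inverse
  (\<open>lift_endpoint_f\<close>).  The Lipschitz bounds and the inclusion of balls come from applying
  the same estimates to the image of a segment under this inverse.
\<close>


section \<open>Sublinear functionals and the Mazur--Orlicz theorem\<close>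

definition sublinear :: "('a::real_vector \<Rightarrow> real) \<Rightarrow> bool" where
  "sublinear q \<longleftrightarrow> (\<forall>x y. q (x + y) \<le> q x + q y) \<and> (\<forall>c x. 0 \<le> c \<longrightarrow> q (c *\<^sub>R x) = c * q x)"

lemma sublinearI:
  assumes "\<And>x y. q (x + y) \<le> q x + q y"
    and "\<And>c x. 0 < c \<Longrightarrow> q (c *\<^sub>R x) \<le> c * q x"
    and "q 0 = 0"
  shows "sublinear q"
proof -
  have "q (c *\<^sub>R x) = c * q x" if "0 < c" for c x
  proof (rule antisym)
    show "q (c *\<^sub>R x) \<le> c * q x" by (rule assms(2)[OF that])
    have "q ((1 / c) *\<^sub>R (c *\<^sub>R x)) \<le> (1 / c) * q (c *\<^sub>R x)"
      using that by (intro assms(2)) simp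
    then show "c * q x \<le> q (c *\<^sub>R x)"
      using that by (simp add: field_simps)
  qed
  then show ?thesis
    using assms(1,3) by (auto simp: sublinear_def order_le_less)
qed

lemma sublinear_add: "sublinear q \<Longrightarrow> q (x + y) \<le> q x + q y"
  and sublinear_scale: "sublinear q \<Longrightarrow> 0 \<le> c \<Longrightarrow> q (c *\<^sub>R x) = c * q x"
  by (auto simp: sublinear_def)

lemma sublinear_zero: "sublinear q \<Longrightarrow> q 0 = 0"
  using sublinear_scale[of q 0 0] by simp

lemma sublinear_minus: "sublinear q \<Longrightarrow> - q (- x) \<le> q x"
  using sublinear_add[of q x "- x"] by (simp add: sublinear_zero)

text \<open>
  The functional \<open>q' x = inf (q (x + t c) - t R)\<close>, with \<open>t \<ge> 0\<close> and \<open>c \<in> C\<close>, is the largest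
  sublinear one below \<open>q\<close> that satisfies \<open>q' (- c) \<le> - R\<close> on \<open>C\<close>.  Every linear functional below \<open>q'\<close> is then at
  least \<open>R\<close> on \<open>C\<close>.  The bound on \<open>q\<close> keeps the infimum finite, and convexity of \<open>C\<close> gives
  subadditivity because \<open>t c + u d\<close> is a multiple of a point of \<open>C\<close>.
\<close>

lemma sublinear_below_convex:
  fixes q :: "'a::real_vector \<Rightarrow> real"
  assumes q: "sublinear q" and C: "convex C" "C \<noteq> {}" and R: "\<And>c. c \<in> C \<Longrightarrow> R \<le> q c"
  obtains q' where "sublinear q'" "\<And>x. q' x \<le> q x" "\<And>c. c \<in> C \<Longrightarrow> q' (- c) \<le> - R"
proof
  define I where "I = {0::real..} \<times> C"
  define v where "v x i = q (x + fst i *\<^sub>R snd i) - fst i * R" for x i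
  define q' where "q' x = (INF i\<in>I. v x i)" for x
  have I: "I \<noteq> {}" using C by (auto simp: I_def)
  have lower: "- q (- x) \<le> v x i" if iI: "i \<in> I" for x i
  proof -
    obtain t c where i: "i = (t, c)" "0 \<le> t" "c \<in> C" using iI by (cases i) (auto simp: I_def)
    have "t * R \<le> q (t *\<^sub>R c)"
      using i R[of c] sublinear_scale[OF q, of t c] by (simp add: mult_left_mono)
    also have "\<dots> \<le> q (x + t *\<^sub>R c) + q (- x)"
      using sublinear_add[OF q, of "x + t *\<^sub>R c" "- x"] by simp
    finally show ?thesis by (simp add: v_def i)
  qed
  then have bdd: "bdd_below (v x ` I)" for x by (auto intro!: bdd_belowI2)
  have upper: "q' x \<le> v x i" if "i \<in> I" for x i
    unfolding q'_def using bdd that by (rule cINF_lower)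
  have greatest: "r \<le> q' x" if "\<And>i. i \<in> I \<Longrightarrow> r \<le> v x i" for r x
    unfolding q'_def using I that by (rule cINF_greatest)
  show le: "q' x \<le> q x" for x
  proof -
    obtain c where "c \<in> C" using C by blast
    then show ?thesis using upper[of "(0, c)" x] by (simp add: I_def v_def)
  qed
  show "q' (- c) \<le> - R" if "c \<in> C" for c
    using upper[of "(1, c)" "- c"] that sublinear_zero[OF q] by (simp add: I_def v_def)
  show "sublinear q'"
  proof (rule sublinearI)
    fix x y
    have split: "q' (x + y) \<le> v x i + v y j" if ij: "i \<in> I" "j \<in> I" for i j
    proof -
      obtain t c u d where i: "i = (t, c)" "0 \<le> t" "c \<in> C" and j: "j = (u, d)" "0 \<le> u" "d \<in> C"
        using ij by (cases i; cases j) (auto simp: I_def)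
      \<comment> \<open>the convex combination of \<open>c\<close> and \<open>d\<close> with weights proportional to \<open>t\<close> and \<open>u\<close>\<close>
      obtain e where e: "e \<in> C" "(t + u) *\<^sub>R e = t *\<^sub>R c + u *\<^sub>R d"
      proof (cases "t + u = 0")
        case True
        then show ?thesis using that[of c] i j by (simp add: add_nonneg_eq_0_iff)
      next
        case False
        then have "0 < t + u" using i j by simp
        moreover have "(t / (t + u)) *\<^sub>R c + (u / (t + u)) *\<^sub>R d \<in> C"
          using i j \<open>0 < t + u\<close> by (intro convexD[OF C(1)]) (auto simp flip: add_divide_distrib)
        ultimately show ?thesis
          by (intro that) (auto simp: scaleR_add_right)
      qed
      have "q' (x + y) \<le> v (x + y) (t + u, e)"
        using i j e by (intro upper) (auto simp: I_def)
      also have "\<dots> = q ((x + t *\<^sub>R c) + (y + u *\<^sub>R d)) - (t + u) * R"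
        unfolding v_def fst_conv snd_conv e(2) by (simp add: ac_simps)
      also have "\<dots> \<le> v x i + v y j"
        using sublinear_add[OF q, of "x + t *\<^sub>R c" "y + u *\<^sub>R d"]
        by (simp add: v_def i j algebra_simps)
      finally show ?thesis .
    qed
    have "q' (x + y) - v x i \<le> q' y" if "i \<in> I" for i
      by (rule greatest) (use split[OF that] in \<open>simp add: algebra_simps\<close>)
    then have "q' (x + y) - q' y \<le> q' x"
      by (intro greatest) (simp add: algebra_simps)
    then show "q' (x + y) \<le> q' x + q' y" by simp
  next
    fix c :: real and x assume c: "0 < c"
    have "q' (c *\<^sub>R x) / c \<le> v x i" if iI: "i \<in> I" for i
    proof -
      obtain t d where i: "i = (t, d)" "0 \<le> t" "d \<in> C" using iI by (cases i) (auto simp: I_def)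
      have "q' (c *\<^sub>R x) \<le> v (c *\<^sub>R x) (c * t, d)"
        using i c by (intro upper) (auto simp: I_def)
      also have "\<dots> = q (c *\<^sub>R (x + t *\<^sub>R d)) - c * t * R"
        by (simp add: v_def algebra_simps)
      also have "\<dots> = c * v x i"
        using c sublinear_scale[OF q, of c "x + t *\<^sub>R d"] by (simp add: v_def i algebra_simps)
      finally show ?thesis using c by (simp add: field_simps)
    qed
    then have "q' (c *\<^sub>R x) / c \<le> q' x" by (rule greatest)
    then show "q' (c *\<^sub>R x) \<le> c * q' x" using c by (simp add: field_simps)
  next
    show "q' 0 = 0"
      using le[of 0] greatest[of 0 0] lower[of _ 0] sublinear_zero[OF q] by (intro antisym) auto
  qed
qed

text \<open>
  Lowering \<open>q\<close> so that \<open>q (- y) \<le> - q y\<close> cannot change a minimal \<open>q\<close>; hence \<open>q\<close> is already odd and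
  thereby additive.
\<close>

lemma minimal_sublinear_linear:
  fixes q :: "'a::real_vector \<Rightarrow> real"
  assumes q: "sublinear q"
    and min: "\<And>q'. sublinear q' \<Longrightarrow> (\<And>x. q' x \<le> q x) \<Longrightarrow> q' = q"
  shows "linear q"
proof -
  have rev: "q x + q y \<le> q (x + y)" for x y
  proof -
    obtain q' where q': "sublinear q'" "\<And>x. q' x \<le> q x" "q' (- y) \<le> - q y"
      using sublinear_below_convex[OF q, of "{y}" "q y"] by auto
    have "q x \<le> q (x + y) + q (- y)"
      using sublinear_add[OF q, of "x + y" "- y"] by simp
    also have "q (- y) \<le> - q y"
      using min[OF q'(1,2)] q'(3) by simp
    finally show ?thesis by simp
  qed
  have add: "q (x + y) = q x + q y" for x y
    using rev sublinear_add[OF q] by (intro antisym)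
  have neg: "q (- x) = - q x" for x
    using add[of x "- x"] sublinear_zero[OF q] by simp
  have "q (c *\<^sub>R x) = c * q x" for c x
  proof (cases "0 \<le> c")
    case True
    then show ?thesis by (rule sublinear_scale[OF q])
  next
    case False
    then have "q ((- c) *\<^sub>R x) = - c * q x" by (intro sublinear_scale[OF q]) simp
    then show ?thesis using neg[of "c *\<^sub>R x"] by simp
  qed
  then show ?thesis using add by (intro linearI) auto
qed

text \<open>
  The pointwise infimum works: it is finite because \<open>p x \<ge> - p (- x) \<ge> - q (- x)\<close>, and it is
  subadditive because two members of a chain have a common lower bound in the chain.
\<close>

lemma chain_of_sublinear_has_lower_bound:
  fixes q :: "'a::real_vector \<Rightarrow> real"
  assumes C: "C \<noteq> {}" "\<And>p. p \<in> C \<Longrightarrow> sublinear p"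
    and chain: "\<And>p p'. p \<in> C \<Longrightarrow> p' \<in> C \<Longrightarrow> p \<le> p' \<or> p' \<le> p"
    and below: "\<And>p. p \<in> C \<Longrightarrow> p \<le> q"
  obtains m where "sublinear m" "\<And>p. p \<in> C \<Longrightarrow> m \<le> p"
proof
  define m where "m x = (INF p\<in>C. p x)" for x
  have lower: "- q (- x) \<le> p x" if "p \<in> C" for p x
    using sublinear_minus[OF C(2)[OF that], of x] below[OF that] by (auto simp: le_fun_def intro: order_trans[rotated])
  then have bdd: "bdd_below ((\<lambda>p. p x) ` C)" for x by (auto intro!: bdd_belowI2)
  have upper: "m x \<le> p x" if "p \<in> C" for x p
    unfolding m_def using bdd that by (rule cINF_lower)
  have greatest: "r \<le> m x" if "\<And>p. p \<in> C \<Longrightarrow> r \<le> p x" for r x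
    unfolding m_def using C(1) that by (rule cINF_greatest)
  show "m \<le> p" if "p \<in> C" for p
    using upper[OF that] by (simp add: le_fun_def)
  show "sublinear m"
  proof (rule sublinearI)
    fix x y
    have split: "m (x + y) \<le> p x + p' y" if pp: "p \<in> C" "p' \<in> C" for p p'
    proof -
      obtain r where r: "r \<in> C" "r \<le> p" "r \<le> p'"
        using chain[OF pp] pp by auto
      have "m (x + y) \<le> r x + r y"
        using upper[OF r(1)] sublinear_add[OF C(2)[OF r(1)]] order_trans by blast
      also have "\<dots> \<le> p x + p' y"
        using r by (intro add_mono) (auto simp: le_fun_def)
      finally show ?thesis .
    qed
    have "m (x + y) - p x \<le> m y" if "p \<in> C" for p
      by (rule greatest) (use split[OF that] in \<open>simp add: algebra_simps\<close>)
    then have "m (x + y) - m y \<le> m x"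
      by (intro greatest) (simp add: algebra_simps)
    then show "m (x + y) \<le> m x + m y" by simp
  next
    fix c :: real and x assume c: "0 < c"
    have "m (c *\<^sub>R x) / c \<le> p x" if "p \<in> C" for p
      using upper[OF that, of "c *\<^sub>R x"] sublinear_scale[OF C(2)[OF that], of c x] c
      by (simp add: field_simps)
    then have "m (c *\<^sub>R x) / c \<le> m x" by (rule greatest)
    then show "m (c *\<^sub>R x) \<le> c * m x" using c by (simp add: field_simps)
  next
    have "p 0 = 0" if "p \<in> C" for p using that C(2) sublinear_zero by blast
    then have "(\<lambda>p. p 0) ` C = {0}" using C(1) by force
    then show "m 0 = 0" by (simp add: m_def)
  qed
qed

text \<open>
  By Zorn's lemma there is a minimal sublinear functional below \<open>q\<close>, and minimal ones are
  linear.
\<close>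

theorem hahn_banach_sublinear:
  fixes q :: "'a::real_vector \<Rightarrow> real"
  assumes q: "sublinear q"
  obtains p where "linear p" "\<And>x. p x \<le> q x"
proof -
  define A where "A = {p. sublinear p \<and> p \<le> q}"
  have "\<exists>m\<in>A. \<forall>a\<in>A. a \<le> m \<longrightarrow> a = m"
  proof (rule predicate_Zorn)
    show "partial_order_on A (relation_of (\<lambda>p p'. p' \<le> p) A)"
      by (rule partial_order_on_relation_ofI) auto
  next
    fix C assume "C \<in> Chains (relation_of (\<lambda>p p'. p' \<le> p) A)"
    then have C: "p \<in> A" and ch: "p \<le> p' \<or> p' \<le> p" if "p \<in> C" "p' \<in> C" for p p'
      using that by (force simp: Chains_def relation_of_def)+
    show "\<exists>u\<in>A. \<forall>a\<in>C. u \<le> a"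
    proof (cases "C = {}")
      case True
      then show ?thesis using q by (auto simp: A_def)
    next
      case False
      obtain m where m: "sublinear m" "\<And>p. p \<in> C \<Longrightarrow> m \<le> p"
        by (rule chain_of_sublinear_has_lower_bound[OF False, of q])
          (use C ch in \<open>auto simp: A_def\<close>)
      obtain p where "p \<in> C" using False by blast
      then have "m \<le> q" using m(2) C by (fastforce simp: A_def)
      then show ?thesis using m by (auto simp: A_def)
    qed
  qed
  then obtain p where p: "p \<in> A" and min: "\<And>a. a \<in> A \<Longrightarrow> a \<le> p \<Longrightarrow> a = p" by blast
  have "linear p"
  proof (rule minimal_sublinear_linear)
    show "sublinear p" using p by (simp add: A_def)
    fix q' :: "'a \<Rightarrow> real" assume q': "sublinear q'" "\<And>x. q' x \<le> p x"
    then have "q' \<le> p" by (simp add: le_fun_def)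
    moreover have "q' \<in> A" using q' p \<open>q' \<le> p\<close> by (auto simp: A_def)
    ultimately show "q' = p" using min by blast
  qed
  with p show ?thesis by (intro that) (auto simp: A_def le_fun_def)
qed

corollary mazur_orlicz:
  fixes q :: "'a::real_vector \<Rightarrow> real"
  assumes q: "sublinear q" and C: "convex C" and R: "\<And>c. c \<in> C \<Longrightarrow> R \<le> q c"
  obtains p where "linear p" "\<And>x. p x \<le> q x" "\<And>c. c \<in> C \<Longrightarrow> R \<le> p c"
proof (cases "C = {}")
  case True
  then show ?thesis using hahn_banach_sublinear[OF q] that by blast
next
  case False
  obtain q' where q': "sublinear q'" "\<And>x. q' x \<le> q x" "\<And>c. c \<in> C \<Longrightarrow> q' (- c) \<le> - R"
    using sublinear_below_convex[OF q C False R] by blast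
  obtain p where p: "linear p" "\<And>x. p x \<le> q' x"
    using hahn_banach_sublinear[OF q'(1)] by blast
  show ?thesis
  proof (rule that[OF p(1)])
    show "p x \<le> q x" for x using p(2) q'(2) order_trans by blast
    show "R \<le> p c" if "c \<in> C" for c
      using p(2)[of "- c"] q'(3)[OF that] linear_neg[OF p(1), of c] by simp
  qed
qed

lemma norm_sublinear: "sublinear (norm :: 'a::real_normed_vector \<Rightarrow> real)"
  by (auto simp: sublinear_def norm_triangle_ineq)

text \<open>
  Mazur--Orlicz for the norm: one functional of norm at most one witnesses the lower bound \<open>R\<close> for
  all elements of the convex set at once.
\<close>

lemma convex_supporting_functional:
  fixes C :: "'a::real_normed_vector set"
  assumes "convex C" and "\<And>c. c \<in> C \<Longrightarrow> R \<le> norm c"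
  obtains p :: "'a \<Rightarrow>\<^sub>L real" where "\<And>x. \<bar>p x\<bar> \<le> norm x" "\<And>c. c \<in> C \<Longrightarrow> R \<le> p c"
proof -
  obtain p where p: "linear p" "\<And>x. p x \<le> norm x" "\<And>c. c \<in> C \<Longrightarrow> R \<le> p c"
    using mazur_orlicz[OF norm_sublinear assms] by blast
  have bound: "\<bar>p x\<bar> \<le> norm x" for x
    using p(2)[of x] p(2)[of "- x"] linear_neg[OF p(1), of x] by auto
  have "bounded_linear p"
    using p(1) bound by (intro bounded_linear.intro bounded_linear_axioms.intro exI[of _ 1])
      (auto simp: linear_iff)
  then show ?thesis
    using that[of "Blinfun p"] bound p(3) by (simp add: bounded_linear_Blinfun_apply)
qed

section \<open>Separating a weak-star closed convex set from a ball of the dual\<close>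

text \<open>
  The subspace \<open>S\<close> is there for the induction on \<open>I\<close>: removing one functional amounts to passing to its
  kernel inside \<open>S\<close>.
\<close>

lemma linear_combination_of_functionals:
  fixes e :: "'i \<Rightarrow> 'v::real_vector \<Rightarrow> real"
  assumes "finite I" "subspace S" and lin: "linear p" "\<And>i. linear (e i)"
    and "\<And>u. u \<in> S \<Longrightarrow> (\<And>i. i \<in> I \<Longrightarrow> e i u = 0) \<Longrightarrow> p u = 0"
  shows "\<exists>c. \<forall>u\<in>S. p u = (\<Sum>i\<in>I. c i * e i u)"
  using assms(1,2,5)
proof (induction I arbitrary: S rule: finite_induct)
  case empty
  then show ?case by simp
next
  case (insert j I)
  define S' where "S' = {u \<in> S. e j u = 0}"
  have "subspace S'"
    using insert.prems(1) lin(2)[of j]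
    by (auto simp: S'_def subspace_def linear_0 linear_add linear_cmul)
  then obtain c where c: "\<forall>u\<in>S'. p u = (\<Sum>i\<in>I. c i * e i u)"
    using insert.IH[of S'] insert.prems(2) by (auto simp: S'_def)
  show ?case
  proof (cases "\<exists>u\<in>S. e j u \<noteq> 0")
    case False
    then have "S' = S" by (auto simp: S'_def)
    have "p u = (\<Sum>i\<in>insert j I. c i * e i u)" if "u \<in> S" for u
      using that c False \<open>S' = S\<close> insert.hyps by simp
    then show ?thesis by blast
  next
    case True
    then obtain u1 where u1: "u1 \<in> S" "e j u1 \<noteq> 0" by blast
    define u0 where "u0 = (1 / e j u1) *\<^sub>R u1"
    have u0: "u0 \<in> S" "e j u0 = 1"
      using u1 insert.prems(1) lin(2)[of j] by (auto simp: u0_def subspace_def linear_cmul)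
    \<comment> \<open>the coefficient of \<open>e j\<close> is forced by evaluating the formula at \<open>u0\<close>\<close>
    define c' where "c' = c(j := p u0 - (\<Sum>i\<in>I. c i * e i u0))"
    have "p u = (\<Sum>i\<in>insert j I. c' i * e i u)" if "u \<in> S" for u
    proof -
      have "u - e j u *\<^sub>R u0 \<in> S'"
        using that u0 insert.prems(1) lin(2)[of j]
        by (auto simp: S'_def linear_diff linear_cmul subspace_diff subspace_scale)
      then have "p (u - e j u *\<^sub>R u0) = (\<Sum>i\<in>I. c i * e i (u - e j u *\<^sub>R u0))"
        using c by blast
      then have "p u = e j u * p u0 + (\<Sum>i\<in>I. c i * (e i u - e j u * e i u0))"
        using lin by (simp add: linear_diff linear_cmul)
      also have "(\<Sum>i\<in>I. c i * (e i u - e j u * e i u0))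
          = (\<Sum>i\<in>I. c i * e i u) - e j u * (\<Sum>i\<in>I. c i * e i u0)"
        by (simp add: sum_distrib_left sum_subtractf algebra_simps)
      also have "(\<Sum>i\<in>I. c i * e i u) = (\<Sum>i\<in>I. c' i * e i u)"
        using insert.hyps by (intro sum.cong) (auto simp: c'_def)
      finally show ?thesis
        using insert.hyps by (simp add: c'_def algebra_simps)
    qed
    then show ?thesis by blast
  qed
qed

text \<open>
  Banach--Alaoglu: inside the product of the intervals \<open>[- s \<parallel>x\<parallel>, s \<parallel>x\<parallel>]\<close>, which is compact
  by Tychonoff, linearity is a closed condition.
\<close>

lemma compact_dual_ball:
  "compact {g :: 'a::real_normed_vector \<Rightarrow> real. linear g \<and> (\<forall>x. \<bar>g x\<bar> \<le> s * norm x)}"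
proof -
  let ?P = "\<Pi>\<^sub>E x\<in>UNIV. {- (s * norm x)..s * norm x} :: ('a \<Rightarrow> real) set"
  have "compact ?P"
    using compactin_PiE[of "\<lambda>_. euclidean" UNIV "\<lambda>x::'a. {- (s * norm x)..s * norm x}"]
    by (simp add: euclidean_product_topology)
  moreover have "closed {g :: 'a \<Rightarrow> real. linear g}"
  proof -
    have "{g :: 'a \<Rightarrow> real. linear g} =
        (\<Inter>x. \<Inter>y. {g. g (x + y) = g x + g y}) \<inter> (\<Inter>c. \<Inter>x. {g. g (c *\<^sub>R x) = c *\<^sub>R g x})"
      by (auto simp: linear_iff)
    also have "closed \<dots>"
      by (intro closed_Int closed_INT ballI closed_Collect_eq continuous_intros
          continuous_on_product_coordinates)
    finally show ?thesis .
  qed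
  ultimately have "compact (?P \<inter> {g. linear g})" by (rule compact_Int_closed)
  also have "?P \<inter> {g. linear g} = {g. linear g \<and> (\<forall>x. \<bar>g x\<bar> \<le> s * norm x)}"
    by (auto simp: PiE_def abs_le_iff minus_le_iff)
  finally show ?thesis .
qed

lemma open_fun_contains_finite_box:
  fixes U :: "('a \<Rightarrow> real) set"
  assumes "open U" "g \<in> U"
  obtains W \<epsilon> where "finite W" "0 < \<epsilon>" "\<And>h. (\<And>w. w \<in> W \<Longrightarrow> \<bar>h w - g w\<bar> < \<epsilon>) \<Longrightarrow> h \<in> U"
proof -
  have "openin (product_topology (\<lambda>_. euclidean) UNIV) U"
    using assms(1) by (simp add: euclidean_product_topology)
  from product_topology_open_contains_basis[OF this assms(2)]
  obtain V where V: "\<And>i. g i \<in> V i" "\<And>i. open (V i)" "finite {i. V i \<noteq> UNIV}"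
    "(\<Pi>\<^sub>E i\<in>UNIV. V i) \<subseteq> U"
    by (auto simp: PiE_iff)
  define W where "W = {i. V i \<noteq> UNIV}"
  have "\<exists>e>0. \<forall>y. \<bar>y - g i\<bar> < e \<longrightarrow> y \<in> V i" for i
    using V(1,2)[of i] by (auto simp: open_dist dist_real_def)
  then obtain e where e: "\<And>i. 0 < e i" "\<And>i y. \<bar>y - g i\<bar> < e i \<Longrightarrow> y \<in> V i" by metis
  \<comment> \<open>the extra element 1 covers the case that \<open>W\<close> is empty\<close>
  define \<epsilon> where "\<epsilon> = Min (insert 1 (e ` W))"
  show ?thesis
  proof
    show fin: "finite W" using V(3) by (simp add: W_def)
    then show "0 < \<epsilon>" using e(1) by (simp add: \<epsilon>_def)
    fix h assume h: "\<And>w. w \<in> W \<Longrightarrow> \<bar>h w - g w\<bar> < \<epsilon>"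
    have "h i \<in> V i" for i
    proof (cases "i \<in> W")
      case True
      then have "\<epsilon> \<le> e i" using fin by (simp add: \<epsilon>_def)
      then show ?thesis using h[OF True] e(2) by fastforce
    qed (simp add: W_def)
    then show "h \<in> U" using V(4) by auto
  qed
qed

text \<open>
  A compact set and a disjoint closed set have positive distance in a uniformity.  For the weak-star
  uniformity this says that finitely many evaluations tell the two sets apart by a fixed amount.
\<close>

lemma weak_star_closed_away_from_ball:
  fixes A :: "('a::real_normed_vector \<Rightarrow>\<^sub>L real) set"
  assumes closed: "closedin strong_operator_topology A"
    and away: "\<And>a. a \<in> A \<Longrightarrow> s < norm a" and s: "0 \<le> s"
  obtains W \<epsilon> where "finite W" "0 < \<epsilon>"
    "\<And>a b. a \<in> A \<Longrightarrow> norm b \<le> s \<Longrightarrow> \<exists>w\<in>W. \<epsilon> \<le> \<bar>blinfun_apply (a - b) w\<bar>"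
proof -
  obtain U where U: "open U" "- A = blinfun_apply -` U"
    using closed unfolding closedin_def strong_operator_topology_topspace
    by (auto simp: strong_operator_topology_def openin_pullback_topology Compl_eq_Diff_UNIV)
  define K :: "('a \<Rightarrow> real) set" where "K = {g. linear g \<and> (\<forall>x. \<bar>g x\<bar> \<le> s * norm x)}"
  have KU: "g \<in> U" if "g \<in> K" for g
  proof -
    have bl: "bounded_linear g"
      using that by (auto simp: K_def linear_iff mult.commute
          intro!: bounded_linear.intro bounded_linear_axioms.intro exI[of _ s])
    then have "norm (Blinfun g) \<le> s"
      using that s by (intro norm_blinfun_bound) (auto simp: K_def bounded_linear_Blinfun_apply)
    then have "Blinfun g \<in> - A" using away by fastforce
    then show ?thesis using bl U(2) by (auto simp: bounded_linear_Blinfun_apply)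
  qed
  \<comment> \<open>the factor 2 leaves room for moving \<open>g\<close> by \<open>\<epsilon>\<close> inside its member of the cover\<close>
  have "\<exists>W \<epsilon>. finite W \<and> 0 < \<epsilon> \<and> (\<forall>h. (\<forall>w\<in>W. \<bar>h w - g w\<bar> < 2 * \<epsilon>) \<longrightarrow> h \<in> U)" if gK: "g \<in> K" for g
  proof -
    obtain W \<epsilon> where "finite W" "0 < \<epsilon>" "\<And>h. (\<And>w. w \<in> W \<Longrightarrow> \<bar>h w - g w\<bar> < \<epsilon>) \<Longrightarrow> h \<in> U"
      using open_fun_contains_finite_box[OF U(1) KU[OF gK]] by blast
    then show ?thesis by (intro exI[of _ W] exI[of _ "\<epsilon> / 2"]) auto
  qed
  then obtain W \<epsilon> where W: "\<And>g. g \<in> K \<Longrightarrow> finite (W g)" "\<And>g. g \<in> K \<Longrightarrow> 0 < \<epsilon> g"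
    and U': "\<And>g h. g \<in> K \<Longrightarrow> (\<And>w. w \<in> W g \<Longrightarrow> \<bar>h w - g w\<bar> < 2 * \<epsilon> g) \<Longrightarrow> h \<in> U"
    by metis
  define N where "N g = {h. \<forall>w\<in>W g. h w \<in> ball (g w) (\<epsilon> g)}" for g
  have "open (N g)" if "g \<in> K" for g
    unfolding N_def using W(1)[OF that] by (intro product_topology_basis') auto
  moreover have "compact K" unfolding K_def by (rule compact_dual_ball)
  moreover have "K \<subseteq> (\<Union>g\<in>K. N g)" using W(2) by (auto simp: N_def)
  ultimately obtain K' where K': "K' \<subseteq> K" "finite K'" "K \<subseteq> (\<Union>g\<in>K'. N g)"
    using compactE_image[of K K N] by metis
  \<comment> \<open>the extra element 1 makes the minimum meaningful when \<open>K'\<close> is empty\<close>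
  define \<epsilon>0 where "\<epsilon>0 = Min (insert 1 (\<epsilon> ` K'))"
  show ?thesis
  proof
    show "finite (\<Union>g\<in>K'. W g)" using K' W(1) by auto
    show "0 < \<epsilon>0" using K' W(2) by (auto simp: \<epsilon>0_def)
    fix a b :: "'a \<Rightarrow>\<^sub>L real" assume a: "a \<in> A" and b: "norm b \<le> s"
    have "\<bar>blinfun_apply b x\<bar> \<le> s * norm x" for x
      using norm_blinfun[of b x] mult_right_mono[OF b norm_ge_zero[of x]] by simp
    then have "blinfun_apply b \<in> K"
      by (auto simp: K_def intro: bounded_linear.linear blinfun.bounded_linear_right)
    then obtain g where g: "g \<in> K'" "blinfun_apply b \<in> N g" using K' by blast
    have "\<epsilon>0 \<le> \<epsilon> g" using g K' by (simp add: \<epsilon>0_def)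
    have "blinfun_apply a \<notin> U" using a U(2) by auto
    then obtain w where w: "w \<in> W g" "2 * \<epsilon> g \<le> \<bar>blinfun_apply a w - g w\<bar>"
      using U'[of g "blinfun_apply a"] g K' by (meson not_le subsetD)
    moreover have "\<bar>blinfun_apply b w - g w\<bar> < \<epsilon> g"
      using g w by (auto simp: N_def dist_real_def)
    ultimately have "\<epsilon>0 \<le> \<bar>blinfun_apply (a - b) w\<bar>"
      using \<open>\<epsilon>0 \<le> \<epsilon> g\<close> by (simp add: blinfun.diff_left)
    then show "\<exists>w\<in>\<Union>g\<in>K'. W g. \<epsilon>0 \<le> \<bar>blinfun_apply (a - b) w\<bar>" using g w by blast
  qed
qed

lemma norming_functional:
  fixes w :: "'a::real_normed_vector"
  assumes "0 \<le> s"
  obtains b :: "'a \<Rightarrow>\<^sub>L real" where "norm b \<le> s" "b w = s * norm w"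
proof -
  obtain p :: "'a \<Rightarrow>\<^sub>L real" where p: "\<And>x. \<bar>p x\<bar> \<le> norm x" "norm w \<le> p w"
    using convex_supporting_functional[of "{w}" "norm w"] by auto
  have "norm p \<le> 1" using p(1) by (intro norm_blinfun_bound) auto
  show ?thesis
  proof
    show "norm (s *\<^sub>R p) \<le> s" using \<open>norm p \<le> 1\<close> assms by (simp add: mult_left_le)
    have "p w = norm w" using p(1)[of w] p(2) by linarith
    then show "blinfun_apply (s *\<^sub>R p) w = s * norm w" by (simp add: blinfun.scaleR_left)
  qed
qed

text \<open>
  Separation by a functional on the dual space is not enough for a descent direction: the functional must be
  evaluation at a vector.  This is ensured by applying Mazur--Orlicz to the seminorm
  \<open>u \<mapsto> \<Sum>w\<in>W. \<bar>u w\<bar>\<close> with finite \<open>W\<close>, because a linear functional below it vanishes on the common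
  kernel of the evaluations in \<open>W\<close> and hence is a linear combination of them.
\<close>

theorem weak_star_separation_from_ball:
  fixes A :: "('a::real_normed_vector \<Rightarrow>\<^sub>L real) set"
  assumes "closedin strong_operator_topology A" and conv: "convex A" and ne: "A \<noteq> {}"
    and away: "\<And>a. a \<in> A \<Longrightarrow> s < norm a" and s: "0 \<le> s"
  obtains w where "norm w = 1" "\<And>a. a \<in> A \<Longrightarrow> s \<le> blinfun_apply a w"
proof -
  obtain W \<epsilon> where W: "finite W" "0 < \<epsilon>"
    "\<And>a b. a \<in> A \<Longrightarrow> norm b \<le> s \<Longrightarrow> \<exists>w\<in>W. \<epsilon> \<le> \<bar>blinfun_apply (a - b) w\<bar>"
    using weak_star_closed_away_from_ball[OF assms(1) away s] by metis
  define q where "q u = (\<Sum>w\<in>W. \<bar>blinfun_apply u w\<bar>)" for u :: "'a \<Rightarrow>\<^sub>L real"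
  define Q where "Q = (\<Union>a\<in>A. \<Union>b\<in>cball 0 s. {a - b})"
  have "sublinear q"
    by (auto simp: sublinear_def q_def blinfun.add_left blinfun.scaleR_left abs_mult
        sum_distrib_left simp flip: sum.distrib intro!: sum_mono)
  moreover have "convex Q"
    unfolding Q_def by (intro convex_differences conv convex_cball)
  moreover have "\<epsilon> \<le> q u" if "u \<in> Q" for u
  proof -
    obtain w where w: "w \<in> W" "\<epsilon> \<le> \<bar>blinfun_apply u w\<bar>"
      using W(3) \<open>u \<in> Q\<close> unfolding Q_def by force
    then show ?thesis
      using member_le_sum[of w W "\<lambda>w. \<bar>blinfun_apply u w\<bar>"] W(1) by (simp add: q_def)
  qed
  ultimately obtain p where p: "linear p" "\<And>u. p u \<le> q u" "\<And>u. u \<in> Q \<Longrightarrow> \<epsilon> \<le> p u"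
    using mazur_orlicz by blast
  have "p u = 0" if "\<And>w. w \<in> W \<Longrightarrow> blinfun_apply u w = 0" for u
    using p(2)[of u] p(2)[of "- u"] that linear_neg[OF p(1), of u]
    by (simp add: q_def blinfun.minus_left)
  moreover have "linear (\<lambda>u. blinfun_apply u w)" for w :: 'a
    by (rule linearI) (auto simp: blinfun.add_left blinfun.scaleR_left)
  ultimately obtain c where c: "\<And>u. p u = (\<Sum>w\<in>W. c w * blinfun_apply u w)"
    using linear_combination_of_functionals[OF W(1) subspace_UNIV p(1), of "\<lambda>w u. blinfun_apply u w"]
    by auto
  define z where "z = (\<Sum>w\<in>W. c w *\<^sub>R w)"
  have pz: "p u = blinfun_apply u z" for u
    by (simp add: c z_def blinfun.sum_right blinfun.scaleR_right)
  \<comment> \<open>compare \<open>a\<close> with the element of the ball of radius \<open>s\<close> that is largest at \<open>z\<close>\<close>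
  have key: "s * norm z + \<epsilon> \<le> blinfun_apply a z" if "a \<in> A" for a
  proof -
    obtain b :: "'a \<Rightarrow>\<^sub>L real" where "norm b \<le> s" "blinfun_apply b z = s * norm z"
      using norming_functional[OF s] by blast
    moreover then have "a - b \<in> Q" using that unfolding Q_def by force
    ultimately show ?thesis using p(3)[of "a - b"] by (simp add: pz blinfun.diff_left)
  qed
  have "z \<noteq> 0"
    using ne key W(2) by fastforce
  show ?thesis
  proof
    show "norm ((1 / norm z) *\<^sub>R z) = 1" using \<open>z \<noteq> 0\<close> by simp
    fix a assume "a \<in> A"
    with key W(2) have "s * norm z \<le> blinfun_apply a z" by fastforce
    then show "s \<le> blinfun_apply a ((1 / norm z) *\<^sub>R z)"
      using \<open>z \<noteq> 0\<close> by (simp add: blinfun.scaleR_right field_simps)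
  qed
qed

section \<open>Expansion and openness from pseudo-Jacobians\<close>

text \<open>
  The supremum of the points up to which the inequality holds is attained by continuity, and the
  derivative bound there would push it further unless it is \<open>b\<close>.
\<close>

lemma dini_mean_value:
  fixes g :: "real \<Rightarrow> real"
  assumes ab: "a \<le> b" and cont: "continuous_on {a..b} g"
    and dini: "\<And>t. a \<le> t \<Longrightarrow> t < b \<Longrightarrow> eventually (\<lambda>h. g (t + h) \<le> g t + K * h) (at_right 0)"
  shows "g b \<le> g a + K * (b - a)"
proof -
  define T where "T = {t \<in> {a..b}. g t \<le> g a + K * (t - a)}"
  define S where "S = {t \<in> {a..b}. {a..t} \<subseteq> T}"
  define c where "c = Sup S"
  have "closed T"
    unfolding T_def by (intro continuous_on_closed_Collect_le continuous_intros cont)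
  have "a \<in> S" using ab by (auto simp: S_def T_def)
  have bdd: "bdd_above S" by (auto simp: S_def)
  have c: "a \<le> c" "c \<le> b"
    unfolding c_def using \<open>a \<in> S\<close>
    by (intro cSup_upper bdd cSup_least; force simp: S_def)+
  have "{a..c} \<subseteq> T"
  proof (cases "a = c")
    case True
    then show ?thesis using ab by (auto simp: T_def)
  next
    case False
    have "{a..<c} \<subseteq> T"
    proof
      fix s assume s: "s \<in> {a..<c}"
      then have "s < Sup S" by (simp add: c_def)
      then obtain t where "t \<in> S" "s < t"
        using less_cSupE[of s S] \<open>a \<in> S\<close> by blast
      then show "s \<in> T" using s by (auto simp: S_def)
    qed
    then have "closure {a..<c} \<subseteq> T" using \<open>closed T\<close> by (rule closure_minimal)
    then show ?thesis using False c by simp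
  qed
  moreover have "c = b"
  proof (rule ccontr)
    assume "c \<noteq> b"
    then have "c < b" using c by simp
    then obtain d where d: "0 < d" "\<And>h. 0 < h \<Longrightarrow> h < d \<Longrightarrow> g (c + h) \<le> g c + K * h"
      using dini[of c] c by (auto simp: eventually_at_right_field)
    define t where "t = min b (c + d / 2)"
    have "t \<in> S"
      unfolding S_def
    proof safe
      show "t \<in> {a..b}" using c d \<open>c < b\<close> by (auto simp: t_def)
      fix s assume s: "s \<in> {a..t}"
      show "s \<in> T"
      proof (cases "s \<le> c")
        case True
        then show ?thesis using \<open>{a..c} \<subseteq> T\<close> s by auto
      next
        case False
        then have "g (c + (s - c)) \<le> g c + K * (s - c)"
          using s d(1) by (intro d(2)) (auto simp: t_def)
        moreover have "g c \<le> g a + K * (c - a)" using \<open>{a..c} \<subseteq> T\<close> c by (auto simp: T_def)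
        ultimately show ?thesis using False s c by (auto simp: T_def t_def algebra_simps)
      qed
    qed
    then have "t \<le> c" unfolding c_def using bdd by (intro cSup_upper)
    then show False using d \<open>c < b\<close> by (auto simp: t_def)
  qed
  ultimately show ?thesis using ab by (auto simp: T_def)
qed

lemma upper_dini_eventually_le:
  assumes "upper_dini \<phi> x v \<le> ereal K" "K < K'"
  shows "eventually (\<lambda>t. \<phi> (x + t *\<^sub>R v) \<le> \<phi> x + K' * t) (at_right 0)"
proof -
  have "upper_dini \<phi> x v < ereal K'"
    using assms by (meson ereal_less(2) le_less_trans less_ereal.simps(1))
  then have "eventually (\<lambda>t. ereal ((\<phi> (x + t *\<^sub>R v) - \<phi> x) / t) < ereal K') (at_right 0)"
    unfolding upper_dini_def by (rule Limsup_lessD)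
  moreover have "eventually (\<lambda>t::real. 0 < t) (at_right 0)" by (rule eventually_at_right_less)
  ultimately show ?thesis
    by eventually_elim (simp add: pos_divide_less_eq)
qed

lemma pseudo_jacobian_mean_value:
  fixes f :: "'a::real_normed_vector \<Rightarrow> 'b::real_normed_vector" and p :: "'b \<Rightarrow>\<^sub>L real"
  assumes B: "convex B" "u \<in> B" "v \<in> B" and cont: "continuous_on B f"
    and pj: "pseudo_jacobian_mapping B f Jf"
    and K: "\<And>z T. z \<in> B \<Longrightarrow> T \<in> Jf z \<Longrightarrow> blinfun_apply p (blinfun_apply T (v - u)) \<le> K"
  shows "blinfun_apply p (f v - f u) \<le> K"
proof (rule field_le_epsilon)
  fix e :: real assume "0 < e"
  define \<gamma> where "\<gamma> t = u + t *\<^sub>R (v - u)" for t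
  have \<gamma>: "\<gamma> t \<in> B" if "0 \<le> t" "t \<le> 1" for t
    using convexD_alt[OF B that] by (simp add: \<gamma>_def algebra_simps)
  have "continuous_on {0..1} (\<lambda>t. f (\<gamma> t))"
    by (rule continuous_on_compose2[OF cont])
      (use \<gamma> in \<open>auto simp: \<gamma>_def intro!: continuous_intros\<close>)
  then have "continuous_on {0..1} (\<lambda>t. blinfun_apply p (f (\<gamma> t)))"
    by (intro continuous_intros)
  moreover have "eventually (\<lambda>h. blinfun_apply p (f (\<gamma> (t + h)))
      \<le> blinfun_apply p (f (\<gamma> t)) + (K + e) * h) (at_right 0)" if t: "0 \<le> t" "t < 1" for t
  proof -
    have z: "\<gamma> t \<in> B" using \<gamma> t by simp
    have "upper_dini (\<lambda>z. blinfun_apply p (f z)) (\<gamma> t) (v - u)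
        \<le> (SUP T\<in>Jf (\<gamma> t). ereal (blinfun_apply p (blinfun_apply T (v - u))))"
      using pj z by (auto simp: pseudo_jacobian_mapping_def is_pseudo_jacobian_def)
    also have "\<dots> \<le> ereal K" using K[OF z] by (intro SUP_least) simp
    finally show ?thesis
      using upper_dini_eventually_le[of _ "\<gamma> t" "v - u" K "K + e"] \<open>0 < e\<close>
      by (simp add: \<gamma>_def algebra_simps)
  qed
  ultimately have "blinfun_apply p (f (\<gamma> 1)) \<le> blinfun_apply p (f (\<gamma> 0)) + (K + e) * (1 - 0)"
    by (intro dini_mean_value) auto
  then show "blinfun_apply p (f v - f u) \<le> K + e"
    by (simp add: \<gamma>_def blinfun.diff_right)
qed

text \<open>
  The mean value inequality is applied to minus the functional that supports the convex set of all \<open>T (v - u)\<close>.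
\<close>

lemma pseudo_jacobian_expansion:
  fixes f :: "'a::real_normed_vector \<Rightarrow> 'b::real_normed_vector"
  assumes B: "convex B" "u \<in> B" "v \<in> B" and cont: "continuous_on B f"
    and pj: "pseudo_jacobian_mapping B f Jf"
    and a: "\<And>T w. T \<in> convex hull (\<Union>z\<in>B. Jf z) \<Longrightarrow> a * norm w \<le> norm (blinfun_apply T w)"
  shows "a * norm (v - u) \<le> norm (f v - f u)"
proof -
  let ?C = "(\<lambda>T. blinfun_apply T (v - u)) ` (convex hull (\<Union>z\<in>B. Jf z))"
  have "linear (\<lambda>T. blinfun_apply T (v - u))"
    by (rule linearI) (auto simp: blinfun.add_left blinfun.scaleR_left)
  then have "convex ?C" by (intro convex_linear_image convex_convex_hull)
  then obtain p :: "'b \<Rightarrow>\<^sub>L real" where p: "\<And>y. \<bar>p y\<bar> \<le> norm y" "\<And>c. c \<in> ?C \<Longrightarrow> a * norm (v - u) \<le> p c"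
    using convex_supporting_functional[of ?C "a * norm (v - u)"] a by auto
  have "blinfun_apply (- p) (f v - f u) \<le> - (a * norm (v - u))"
  proof (rule pseudo_jacobian_mean_value[OF B cont pj])
    fix z T assume "z \<in> B" "T \<in> Jf z"
    then have "T \<in> convex hull (\<Union>z\<in>B. Jf z)" by (meson UN_I hull_inc)
    then show "blinfun_apply (- p) (blinfun_apply T (v - u)) \<le> - (a * norm (v - u))"
      using p(2) by (simp add: blinfun.minus_left)
  qed
  then show ?thesis using p(1)[of "f v - f u"] by (simp add: blinfun.minus_left)
qed

lemma norm_compose_ge_of_surj:
  fixes p :: "'b::real_normed_vector \<Rightarrow>\<^sub>L real" and T :: "'a::real_normed_vector \<Rightarrow>\<^sub>L 'b"
  assumes "0 < a" and a: "\<And>w. a * norm w \<le> norm (blinfun_apply T w)" and surj: "surj (blinfun_apply T)"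
  shows "a * norm p \<le> norm (p o\<^sub>L T)"
proof -
  have "norm p \<le> norm (p o\<^sub>L T) / a"
  proof (rule norm_blinfun_bound)
    fix y
    obtain w where w: "y = blinfun_apply T w" using surj by (metis surjD)
    have "norm (blinfun_apply p y) \<le> norm (p o\<^sub>L T) * norm w"
      using norm_blinfun[of "p o\<^sub>L T" w] by (simp add: w)
    also have "\<dots> \<le> norm (p o\<^sub>L T) * (norm y / a)"
      using a[of w] \<open>0 < a\<close> by (intro mult_left_mono) (auto simp: w field_simps)
    finally show "norm (blinfun_apply p y) \<le> norm (p o\<^sub>L T) / a * norm y" by simp
  qed (use \<open>0 < a\<close> in auto)
  then show ?thesis using \<open>0 < a\<close> by (simp add: field_simps)
qed

text \<open>
  A subgradient \<open>p\<close> of the distance to \<open>y\<close> at \<open>f x\<close> satisfies \<open>p (f x - y) \<ge> \<parallel>f x - y\<parallel>\<close>, so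
  its norm is at least one; composing with a surjection of co-norm at least \<open>a\<close> loses at most the
  factor \<open>a\<close>.  The closure costs nothing, since the estimate is a closed condition on the operator.
\<close>

lemma chain_set_norm_ge:
  fixes f :: "'a::real_normed_vector \<Rightarrow> 'b::real_normed_vector"
  assumes "y \<noteq> f x" and "0 < a"
    and iso: "\<And>T. T \<in> convex hull (Jf x) \<Longrightarrow> surj (blinfun_apply T)"
    and a: "\<And>T w. T \<in> convex hull (Jf x) \<Longrightarrow> a * norm w \<le> norm (blinfun_apply T w)"
    and q: "q \<in> chain_set f Jf x y"
  shows "a \<le> norm q"
proof -
  obtain p T where pT: "q = p o\<^sub>L T" "p \<in> clarke_subdifferential (dist_fun y) (f x)"
    "T \<in> closure (convex hull (Jf x))"
    using q by (auto simp: chain_set_def)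
  have "norm (f x - y) + blinfun_apply p (y - f x) \<le> 0"
    using pT(2) unfolding clarke_subdifferential_dist_fun by (auto simp: dist_fun_def dest: spec[of _ y])
  moreover have "- blinfun_apply p (y - f x) \<le> norm p * norm (f x - y)"
    using norm_blinfun[of p "y - f x"] by (simp add: norm_minus_commute abs_le_iff)
  ultimately have "1 * norm (f x - y) \<le> norm p * norm (f x - y)" by simp
  then have "1 \<le> norm p" using assms(1) by (subst (asm) mult_le_cancel_right) auto
  have "closed {T. a * norm p \<le> norm (p o\<^sub>L T)}"
    by (intro closed_Collect_le continuous_intros
        bounded_linear.continuous_on[OF bounded_bilinear.bounded_linear_right[OF bounded_bilinear_blinfun_compose]])
  then have "closure (convex hull (Jf x)) \<subseteq> {T. a * norm p \<le> norm (p o\<^sub>L T)}"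
  proof (rule closure_minimal[rotated])
    show "convex hull (Jf x) \<subseteq> {T. a * norm p \<le> norm (p o\<^sub>L T)}"
      using norm_compose_ge_of_surj[OF \<open>0 < a\<close> a iso] by (intro subsetI CollectI)
  qed
  then have "a * norm p \<le> norm (p o\<^sub>L T)"
    using pT(3) by auto
  moreover have "a * 1 \<le> a * norm p"
    using \<open>1 \<le> norm p\<close> \<open>0 < a\<close> by (intro mult_left_mono) auto
  ultimately show ?thesis by (simp add: pT(1))
qed

text \<open>
  If \<open>w\<close> separates the chain set from the dual ball of radius \<open>s\<close>, every element of the chain
  set is at most \<open>- s\<close> at \<open>- w\<close>, and the pseudo-Jacobian inequality makes this a bound for the directional derivative.
\<close>

lemma descent_direction:
  fixes f :: "'a::real_normed_vector \<Rightarrow> 'b::real_normed_vector"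
  assumes chain: "chain_rule_condition U f Jf" "x \<in> U" "y \<noteq> f x"
    and iso: "\<And>T. T \<in> convex hull (Jf x) \<Longrightarrow> surj (blinfun_apply T)"
    and a: "\<And>T w. T \<in> convex hull (Jf x) \<Longrightarrow> a * norm w \<le> norm (blinfun_apply T w)"
    and s: "0 \<le> s" "s < a"
  obtains w where "norm w = 1" "upper_dini (dist_fun y \<circ> f) x w \<le> ereal (- s)"
proof -
  let ?A = "chain_set f Jf x y"
  have A: "closedin strong_operator_topology ?A" "convex ?A" "is_pseudo_jacobian (dist_fun y \<circ> f) x ?A"
    using chain by (auto simp: chain_rule_condition_def)
  have away: "s < norm q" if "q \<in> ?A" for q
    using chain_set_norm_ge[OF chain(3) _ iso a that] s by fastforce
  have "?A \<noteq> {}" using A(3) by (simp add: is_pseudo_jacobian_def)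
  obtain w where w: "norm w = 1" "\<And>q. q \<in> ?A \<Longrightarrow> s \<le> blinfun_apply q w"
    using weak_star_separation_from_ball[OF A(1,2) \<open>?A \<noteq> {}\<close> away s(1)] by blast
  show ?thesis
  proof
    show "norm (- w) = 1" using w by simp
    have "upper_dini (\<lambda>z. blinfun_apply id_blinfun ((dist_fun y \<circ> f) z)) x (- w)
        \<le> (SUP q\<in>?A. ereal (blinfun_apply id_blinfun (blinfun_apply q (- w))))"
      using A(3) unfolding is_pseudo_jacobian_def by blast
    also have "\<dots> \<le> ereal (- s)"
      using w(2) by (intro SUP_least) (simp add: blinfun.minus_right)
    finally show "upper_dini (dist_fun y \<circ> f) x (- w) \<le> ereal (- s)" by (simp add: comp_def)
  qed
qed

text \<open>
  The sets \<open>D z\<close> of points that are reached from \<open>z\<close> by a decrease of \<open>\<phi>\<close> proportional to the distance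
  are nested along the iteration.  Halving the possible decrease at every step forces the iterates to
  converge to a point from which no further decrease is possible.
\<close>

lemma ekeland_variational_principle:
  fixes \<phi> :: "'a::metric_space \<Rightarrow> real"
  assumes S: "complete S" and cont: "continuous_on S \<phi>" and low: "\<And>u. u \<in> S \<Longrightarrow> 0 \<le> \<phi> u"
    and "x \<in> S" "0 < k"
  obtains z where "z \<in> S" "\<phi> z + k * dist x z \<le> \<phi> x"
    "\<And>u. u \<in> S \<Longrightarrow> \<phi> u + k * dist z u \<le> \<phi> z \<Longrightarrow> u = z"
proof -
  define D where "D z = {u \<in> S. \<phi> u + k * dist z u \<le> \<phi> z}" for z
  have D_refl: "z \<in> D z" if "z \<in> S" for z using that by (simp add: D_def)
  have D_trans: "v \<in> D z" if "u \<in> D z" "v \<in> D u" for u v z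
    using that mult_left_mono[OF dist_triangle[of z v u], of k] \<open>0 < k\<close>
    by (auto simp: D_def algebra_simps)
  define m where "m z = (INF u\<in>D z. \<phi> u)" for z
  have m: "m z \<le> \<phi> u" if "u \<in> D z" for z u
    unfolding m_def using low that by (intro cINF_lower bdd_belowI2[of _ 0]) (auto simp: D_def)
  \<comment> \<open>a point of \<open>D z\<close> that realises at least half of the possible decrease of \<open>\<phi>\<close>\<close>
  have "\<exists>u. u \<in> D z \<and> 2 * \<phi> u \<le> \<phi> z + m z" if "z \<in> S" for z
  proof (cases "m z < \<phi> z")
    case True
    have "bdd_below (\<phi> ` D z)" using low by (intro bdd_belowI2[of _ 0]) (auto simp: D_def)
    then have "\<exists>u\<in>D z. \<phi> u < (\<phi> z + m z) / 2"
      using True D_refl[OF that] by (subst cINF_less_iff[symmetric]) (auto simp: m_def)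
    then show ?thesis by force
  next
    case False
    then show ?thesis using D_refl[OF that] by (intro exI[of _ z]) auto
  qed
  then obtain N where N: "\<And>z. z \<in> S \<Longrightarrow> N z \<in> D z" "\<And>z. z \<in> S \<Longrightarrow> 2 * \<phi> (N z) \<le> \<phi> z + m z"
    by metis
  define Z where "Z n = (N ^^ n) x" for n
  have ZS: "Z n \<in> S" for n
    by (induction n) (use \<open>x \<in> S\<close> N(1) in \<open>auto simp: Z_def D_def\<close>)
  have ZD: "Z (n + j) \<in> D (Z n)" for n j
  proof (induction j)
    case (Suc j)
    have "Z (n + Suc j) \<in> D (Z (n + j))" using N(1)[OF ZS[of "n + j"]] by (simp add: Z_def)
    then show ?case using Suc D_trans by blast
  qed (use D_refl ZS in auto)
  have ineq: "\<phi> (Z j) + k * dist (Z n) (Z j) \<le> \<phi> (Z n)" if "n \<le> j" for n j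
    using ZD[of n "j - n"] that by (simp add: D_def)
  have "decseq (\<lambda>n. \<phi> (Z n))"
    unfolding decseq_def
  proof (intro allI impI)
    fix n j :: nat assume "n \<le> j"
    moreover have "0 \<le> k * dist (Z n) (Z j)" using \<open>0 < k\<close> by simp
    ultimately show "\<phi> (Z j) \<le> \<phi> (Z n)" using ineq by fastforce
  qed
  then obtain l where l: "(\<lambda>n. \<phi> (Z n)) \<longlonglongrightarrow> l" "\<And>n. l \<le> \<phi> (Z n)"
    using decseq_convergent[of "\<lambda>n. \<phi> (Z n)" 0] low ZS by blast
  have "Cauchy Z"
  proof (rule metric_CauchyI)
    fix e :: real assume "0 < e"
    then have "eventually (\<lambda>n. \<phi> (Z n) < l + k * e / 2) sequentially"
      using l(1) \<open>0 < k\<close> by (intro order_tendstoD(2)) auto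
    then obtain M where M: "\<And>n. M \<le> n \<Longrightarrow> \<phi> (Z n) < l + k * e / 2"
      by (auto simp: eventually_sequentially)
    have *: "dist (Z M) (Z n) < e / 2" if "M \<le> n" for n
    proof -
      have "k * dist (Z M) (Z n) < k * (e / 2)"
        using ineq[OF that] M[of M] l(2)[of n] by simp
      then show ?thesis using \<open>0 < k\<close> by (simp add: mult_less_cancel_left_pos)
    qed
    have "dist (Z n) (Z j) < e" if "M \<le> n" "M \<le> j" for n j
      using *[OF that(1)] *[OF that(2)] dist_triangle_half_r by (metis dist_commute)
    then show "\<exists>M. \<forall>n\<ge>M. \<forall>j\<ge>M. dist (Z n) (Z j) < e" by blast
  qed
  then obtain z where z: "z \<in> S" "Z \<longlonglongrightarrow> z"
    using S ZS unfolding complete_def by blast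
  have "(\<lambda>n. \<phi> (Z n)) \<longlonglongrightarrow> \<phi> z"
    using continuous_on_tendsto_compose[OF cont z(2,1)] ZS by simp
  then have "\<phi> z = l" using l(1) LIMSEQ_unique by blast
  have zD: "z \<in> D (Z n)" for n
  proof -
    have "(\<lambda>j. \<phi> (Z j) + k * dist (Z n) (Z j)) \<longlonglongrightarrow> \<phi> z + k * dist (Z n) z"
      using l(1) z(2) \<open>\<phi> z = l\<close> by (auto intro!: tendsto_intros)
    then have "\<phi> z + k * dist (Z n) z \<le> \<phi> (Z n)"
      by (rule LIMSEQ_le_const2) (use ineq in blast)
    then show ?thesis using z by (simp add: D_def)
  qed
  show ?thesis
  proof
    show "z \<in> S" by fact
    show "\<phi> z + k * dist x z \<le> \<phi> x" using zD[of 0] by (simp add: D_def Z_def)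
    fix u assume u: "u \<in> S" "\<phi> u + k * dist z u \<le> \<phi> z"
    then have "u \<in> D z" by (simp add: D_def)
    then have uD: "u \<in> D (Z n)" for n by (rule D_trans[OF zD])
    have "2 * \<phi> (Z (Suc n)) - \<phi> (Z n) \<le> \<phi> u" for n
      using N(2)[OF ZS[of n]] m[OF uD, of n] by (simp add: Z_def)
    moreover have "(\<lambda>n. 2 * \<phi> (Z (Suc n)) - \<phi> (Z n)) \<longlonglongrightarrow> 2 * l - l"
      by (intro tendsto_intros LIMSEQ_Suc l(1))
    ultimately have "l \<le> \<phi> u" using LIMSEQ_le_const2 by fastforce
    then have "k * dist z u \<le> 0" using u \<open>\<phi> z = l\<close> by simp
    then show "u = z" using \<open>0 < k\<close> by (simp add: mult_le_0_iff)
  qed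
qed

text \<open>
  Ekeland's principle for the distance of \<open>f\<close> to \<open>y\<close>, with a slope \<open>k\<close> strictly between the value
  forced by \<open>dist (f x) y < s \<delta>\<close> and the descent rate \<open>s\<close>, gives a point inside the open ball from which
  descent at rate \<open>k\<close> is impossible.  Only \<open>f z = y\<close> is compatible with that.
\<close>

lemma descent_implies_open_covering:
  fixes f :: "'a::banach \<Rightarrow> 'b::real_normed_vector"
  assumes cont: "continuous_on (cball x \<delta>) f" and "0 < \<delta>"
    and desc: "\<And>y z. z \<in> ball x \<delta> \<Longrightarrow> y \<noteq> f z \<Longrightarrow>
      \<exists>w. norm w = 1 \<and> upper_dini (dist_fun y \<circ> f) z w \<le> ereal (- s)"
  shows "ball (f x) (s * \<delta>) \<subseteq> f ` ball x \<delta>"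
proof
  fix y assume y: "y \<in> ball (f x) (s * \<delta>)"
  define \<phi> where "\<phi> = dist_fun y \<circ> f"
  have \<phi>: "\<phi> u = dist (f u) y" for u by (simp add: \<phi>_def dist_fun_def dist_norm)
  have "dist (f x) y / \<delta> < s" using y \<open>0 < \<delta>\<close> by (simp add: field_simps)
  then obtain k where k: "dist (f x) y / \<delta> < k" "k < s" using dense by blast
  have "0 \<le> dist (f x) y / \<delta>" using \<open>0 < \<delta>\<close> by simp
  with k have "0 < k" by linarith
  have "continuous_on (cball x \<delta>) \<phi>" unfolding \<phi> by (intro continuous_intros cont)
  then obtain z where z: "z \<in> cball x \<delta>" "\<phi> z + k * dist x z \<le> \<phi> x"
    and min: "\<And>u. u \<in> cball x \<delta> \<Longrightarrow> \<phi> u + k * dist z u \<le> \<phi> z \<Longrightarrow> u = z"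
    using ekeland_variational_principle[of "cball x \<delta>" \<phi> x k] \<open>0 < k\<close> \<open>0 < \<delta>\<close>
    by (auto simp: \<phi> complete_eq_closed)
  have "k * dist x z < k * \<delta>"
  proof -
    have "k * dist x z \<le> dist (f x) y" using z(2) zero_le_dist[of "f z" y] unfolding \<phi> by linarith
    also have "\<dots> < k * \<delta>" using k(1) \<open>0 < \<delta>\<close> by (simp add: pos_divide_less_eq)
    finally show ?thesis .
  qed
  then have zb: "z \<in> ball x \<delta>" using \<open>0 < k\<close> by simp
  have "y = f z"
  proof (rule ccontr)
    assume "y \<noteq> f z"
    then obtain w where w: "norm w = 1" "upper_dini \<phi> z w \<le> ereal (- s)"
      using desc[OF zb] by (auto simp: \<phi>_def)
    then have ev: "eventually (\<lambda>t. \<phi> (z + t *\<^sub>R w) \<le> \<phi> z + (- k) * t) (at_right 0)"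
      using k(2) by (intro upper_dini_eventually_le) auto
    have "((\<lambda>t. z + t *\<^sub>R w) \<longlongrightarrow> z + 0 *\<^sub>R w) (at_right 0)" by (intro tendsto_intros)
    then have "eventually (\<lambda>t. z + t *\<^sub>R w \<in> ball x \<delta>) (at_right 0)"
      using zb by (intro topological_tendstoD) auto
    moreover have "eventually (\<lambda>t::real. 0 < t) (at_right 0)" by (rule eventually_at_right_less)
    ultimately have "eventually (\<lambda>t. \<phi> (z + t *\<^sub>R w) \<le> \<phi> z + (- k) * t \<and> z + t *\<^sub>R w \<in> ball x \<delta> \<and> 0 < t) (at_right 0)"
      using ev by eventually_elim simp
    then obtain t where t: "\<phi> (z + t *\<^sub>R w) \<le> \<phi> z + (- k) * t" "z + t *\<^sub>R w \<in> ball x \<delta>" "0 < t"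
      using eventually_happens'[OF trivial_limit_at_right_real] by blast
    then have "z + t *\<^sub>R w = z"
      using w(1) by (intro min) (auto simp: dist_norm)
    then show False using t(3) w(1) by auto
  qed
  then show "y \<in> f ` ball x \<delta>" using zb by blast
qed

section \<open>Locally expanding open maps and radial integrals\<close>

definition radial_integral :: "(real \<Rightarrow> ennreal) \<Rightarrow> real \<Rightarrow> ennreal" where
  "radial_integral m r = (\<integral>\<^sup>+t\<in>{0..r}. m t \<partial>lborel)"

lemma radial_integral_mono: "r \<le> r' \<Longrightarrow> radial_integral m r \<le> radial_integral m r'"
  unfolding radial_integral_def
  by (intro nn_integral_mono mult_left_mono) (auto simp: indicator_def)

lemma radial_integral_0: "radial_integral m 0 = 0"
proof -
  have "radial_integral m 0 = (\<integral>\<^sup>+t. m 0 * indicator {0::real} t \<partial>lborel)"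
    unfolding radial_integral_def by (intro nn_integral_cong) (auto simp: indicator_def)
  also have "\<dots> = 0" by (subst nn_integral_cmult_indicator) auto
  finally show ?thesis .
qed

context
  fixes m :: "real \<Rightarrow> ennreal" and b :: real
  assumes anti: "antimono m" and fin: "m 0 \<le> ennreal b"
begin

lemma antimono_times_indicator_measurable: "(\<lambda>t. m t * indicator {0..r} t) \<in> borel_measurable lborel"
proof -
  have m_fin: "m t < \<infinity>" if "0 \<le> t" for t
    using antimonoD[OF anti that] fin by (auto simp: less_top[symmetric] top_unique)
  \<comment> \<open>\<open>m\<close> may be infinite at negative arguments, hence the truncation at 0\<close>
  define g where "g t = - enn2real (m (max 0 t))" for t
  have "mono g"
    unfolding g_def by (intro monoI) (auto intro!: enn2real_mono antimonoD[OF anti] m_fin[unfolded infinity_ennreal_def])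
  then have [measurable]: "g \<in> borel_measurable borel" by (rule borel_measurable_mono)
  have "(\<lambda>t. m t * indicator {0..r} t) = (\<lambda>t. ennreal (- g t) * indicator {0..r} t)"
    using m_fin by (auto simp: g_def indicator_def fun_eq_iff)
  then show ?thesis by simp
qed

text \<open>
  As \<open>m\<close> decreases, its value at the inner radius bounds it on the whole annulus; this is what allows the
  radial integral to be compared with the expansion factor at the current point of a lift.
\<close>

lemma radial_integral_increment:
  assumes "0 \<le> r" "r \<le> r'"
  shows "radial_integral m r' \<le> radial_integral m r + m r * ennreal (r' - r)"
proof -
  have "radial_integral m r' \<le> (\<integral>\<^sup>+t. m t * indicator {0..r} t + m r * indicator {r<..r'} t \<partial>lborel)"
    unfolding radial_integral_def
    by (intro nn_integral_mono) (auto simp: indicator_def intro: antimonoD[OF anti])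
  also have "\<dots> = radial_integral m r + m r * ennreal (r' - r)"
    using assms unfolding radial_integral_def
    by (subst nn_integral_add) (auto simp: nn_integral_cmult_indicator antimono_times_indicator_measurable[simplified])
  finally show ?thesis .
qed

lemma radial_integral_finite: "radial_integral m r < \<infinity>"
proof (cases "0 \<le> r")
  case True
  then have "radial_integral m r \<le> m 0 * ennreal r"
    using radial_integral_increment[of 0 r] by (simp add: radial_integral_0)
  also have "\<dots> \<le> ennreal b * ennreal r" by (intro mult_right_mono fin) simp
  also have "\<dots> < \<infinity>" by (simp add: ennreal_mult_less_top)
  finally show ?thesis .
next
  case False
  then show ?thesis
    using radial_integral_mono[of r 0 m] by (simp add: radial_integral_0)
qed

lemma radial_integral_real_increment:
  assumes "0 \<le> r" "r \<le> r'" "m r \<le> ennreal B" "0 \<le> B"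
  shows "enn2real (radial_integral m r') \<le> enn2real (radial_integral m r) + B * (r' - r)"
proof -
  have "radial_integral m r' \<le> radial_integral m r + ennreal B * ennreal (r' - r)"
    using radial_integral_increment[OF assms(1,2)] mult_right_mono[OF assms(3)]
    by (meson add_left_mono order_trans zero_le)
  also have "\<dots> = ennreal (enn2real (radial_integral m r) + B * (r' - r))"
    using assms radial_integral_finite[of r] by (simp add: ennreal_mult)
  finally show ?thesis
    using assms by (intro enn2real_leI) auto
qed

lemma radial_integral_unbounded:
  assumes div: "(\<integral>\<^sup>+t\<in>{0..}. m t \<partial>lborel) = \<infinity>"
  obtains n :: nat where "ennreal L < radial_integral m (real n)"
proof -
  have "(SUP n::nat. m t * indicator {0..real n} t) = m t * indicator {0..} t" for t
  proof (rule antisym)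
    show "(SUP n::nat. m t * indicator {0..real n} t) \<le> m t * indicator {0..} t"
      by (rule SUP_least) (auto simp: indicator_def)
    obtain n :: nat where "t \<le> real n" using real_arch_simple by blast
    then show "m t * indicator {0..} t \<le> (SUP n::nat. m t * indicator {0..real n} t)"
      by (intro SUP_upper2[of n]) (auto simp: indicator_def)
  qed
  then have "\<infinity> = (\<integral>\<^sup>+t. (SUP n::nat. m t * indicator {0..real n} t) \<partial>lborel)"
    using div by simp
  also have "\<dots> = (SUP n::nat. radial_integral m (real n))"
    unfolding radial_integral_def
    by (intro nn_integral_monotone_convergence_SUP antimono_times_indicator_measurable)
      (auto simp: incseq_def le_fun_def indicator_def)
  finally have "ennreal L < (SUP n::nat. radial_integral m (real n))"
    by (metis ennreal_less_top infinity_ennreal_def)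
  then show ?thesis using that by (auto simp: less_SUP_iff)
qed

text \<open>
  A zero of the decreasing function \<open>m\<close> would bound all radial integrals by the one up to that zero.
\<close>

lemma rate_pos_of_divergent:
  assumes div: "(\<integral>\<^sup>+t\<in>{0..}. m t \<partial>lborel) = \<infinity>"
  shows "0 < m r"
proof (rule ccontr)
  assume "\<not> 0 < m r"
  define r0 where "r0 = max 0 r"
  have "m r0 = 0" using \<open>\<not> 0 < m r\<close> antimonoD[OF anti, of r r0] by (simp add: r0_def)
  obtain n where n: "ennreal (enn2real (radial_integral m r0)) < radial_integral m (real n)"
    using radial_integral_unbounded[OF div] by blast
  have "radial_integral m (real n) \<le> radial_integral m (max r0 (real n))"
    by (intro radial_integral_mono) simp
  also have "\<dots> \<le> radial_integral m r0"
    using radial_integral_increment[of r0 "max r0 (real n)"] \<open>m r0 = 0\<close> by (simp add: r0_def)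
  finally show False using n radial_integral_finite[of r0] by simp
qed

end

text \<open>
  The abstract situation behind the theorem: an open map that near \<open>x\<close> expands distances by every
  factor below \<open>\<beta> x\<close>.
\<close>

locale locally_expanding =
  fixes f :: "'a::banach \<Rightarrow> 'b::real_normed_vector" and \<beta> :: "'a \<Rightarrow> real"
  assumes cont: "continuous_on UNIV f"
    and open_image: "\<And>U. open U \<Longrightarrow> open (f ` U)"
    and \<beta>_pos: "\<And>x. 0 < \<beta> x"
    and expands: "\<And>x a. a < \<beta> x \<Longrightarrow>
      \<exists>r>0. \<forall>u\<in>ball x r. \<forall>v\<in>ball x r. a * dist u v \<le> dist (f u) (f v)"
begin

definition rate :: "'a \<Rightarrow> real \<Rightarrow> ennreal" where
  "rate x0 t = (INF x\<in>{x. norm (x - x0) \<le> t}. ennreal (\<beta> x))"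

lemma rate_le: "norm (x - x0) \<le> t \<Longrightarrow> rate x0 t \<le> ennreal (\<beta> x)"
  unfolding rate_def by (intro INF_lower) simp

lemma antimono_rate: "antimono (rate x0)"
  unfolding rate_def by (intro antimonoI INF_superset_mono) auto

lemma rate_0_le: "rate x0 0 \<le> ennreal (\<beta> x0)"
  by (rule rate_le) simp

lemma locally_injective:
  obtains r where "0 < r" "inj_on f (ball x r)"
proof -
  obtain r where r: "0 < r"
    "\<And>u v. u \<in> ball x r \<Longrightarrow> v \<in> ball x r \<Longrightarrow> \<beta> x / 2 * dist u v \<le> dist (f u) (f v)"
    using expands[of "\<beta> x / 2" x] \<beta>_pos[of x] by auto
  have "inj_on f (ball x r)"
  proof (rule inj_onI)
    fix u v assume "u \<in> ball x r" "v \<in> ball x r" "f u = f v"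
    with r(2)[of u v] \<beta>_pos[of x] show "u = v" by (simp add: mult_le_0_iff)
  qed
  with r(1) that show ?thesis by blast
qed

lemma local_inverse:
  obtains r g where "0 < r" "open (f ` ball x r)" "continuous_on (f ` ball x r) g"
    "\<forall>u\<in>ball x r. g (f u) = u"
proof -
  obtain r where r: "0 < r" "inj_on f (ball x r)" by (rule locally_injective)
  define g where "g = inv_into (ball x r) f"
  have g: "g (f u) = u" if "u \<in> ball x r" for u
    using that r(2) by (simp add: g_def)
  have "continuous_on (f ` ball x r) g"
  proof (rule continuous_on_inverse_open_map[of "ball x r" f])
    show "continuous_on (ball x r) f" using cont continuous_on_subset by blast
    show "openin (top_of_set (f ` ball x r)) (f ` U)" if "openin (top_of_set (ball x r)) U" for U
    proof -
      have "open U" using that by (simp add: openin_open_eq)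
      then show ?thesis
        using open_image that openin_subset by (metis image_mono open_subset topspace_euclidean_subtopology)
    qed
  qed (use g in auto)
  then show ?thesis using that[of r g] r(1) g open_image[OF open_ball] by blast
qed

lemma lift_speed:
  assumes c: "continuous_on {0..\<tau>} c" "\<And>t. t \<in> {0..\<tau>} \<Longrightarrow> f (c t) = y + t *\<^sub>R v"
    and t: "0 \<le> t" "t < \<tau>" and a: "0 < a" "a < \<beta> (c t)"
  shows "eventually (\<lambda>h. norm (c (t + h) - c t) \<le> norm v / a * h) (at_right 0)"
proof -
  obtain r where r: "0 < r"
    "\<And>u w. u \<in> ball (c t) r \<Longrightarrow> w \<in> ball (c t) r \<Longrightarrow> a * dist u w \<le> dist (f u) (f w)"
    using expands[OF a(2)] by blast
  obtain d where d: "0 < d" "\<And>s. s \<in> {0..\<tau>} \<Longrightarrow> dist s t < d \<Longrightarrow> dist (c s) (c t) < r"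
    using c(1) t r(1) unfolding continuous_on_iff by (metis atLeastAtMost_iff less_imp_le)
  have "norm (c (t + h) - c t) \<le> norm v / a * h" if h: "0 < h" "h < min d (\<tau> - t)" for h
  proof -
    have "dist (c (t + h)) (c t) < r" using h t by (intro d(2)) (auto simp: dist_real_def)
    then have "a * dist (c (t + h)) (c t) \<le> dist (f (c (t + h))) (f (c t))"
      using r(1) by (intro r(2)) (auto simp: dist_commute)
    also have "\<dots> = h * norm v"
      using h t by (simp add: c(2) dist_norm scaleR_add_left)
    finally show ?thesis using a(1) by (simp add: dist_norm field_simps)
  qed
  then show ?thesis
    using d(1) t by (auto simp: eventually_at_right_field intro!: exI[of _ "min d (\<tau> - t)"])
qed

lemma lift_lipschitz:
  assumes c: "continuous_on {0..\<tau>} c" "\<And>t. t \<in> {0..\<tau>} \<Longrightarrow> f (c t) = y + t *\<^sub>R v"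
    and st: "0 \<le> s" "s \<le> t" "t \<le> \<tau>" and a: "0 < a" "\<And>t. t \<in> {0..\<tau>} \<Longrightarrow> a < \<beta> (c t)"
  shows "norm (c t - c s) \<le> norm v / a * (t - s)"
proof -
  have "norm (c t - c s) \<le> norm (c s - c s) + norm v / a * (t - s)"
  proof (rule dini_mean_value[OF st(2)])
    show "continuous_on {s..t} (\<lambda>u. norm (c u - c s))"
      using st by (intro continuous_intros continuous_on_subset[OF c(1)]) auto
    fix u assume u: "s \<le> u" "u < t"
    then have "eventually (\<lambda>h. norm (c (u + h) - c u) \<le> norm v / a * h) (at_right 0)"
      using st a by (intro lift_speed[OF c]) auto
    then show "eventually (\<lambda>h. norm (c (u + h) - c s) \<le> norm (c u - c s) + norm v / a * h) (at_right 0)"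
    proof eventually_elim
      case (elim h)
      then show ?case using norm_triangle_ineq[of "c (u + h) - c u" "c u - c s"] by simp
    qed
  qed
  then show ?thesis by simp
qed

text \<open>
  At time \<open>t\<close> the distance \<open>r\<close> from the starting point grows with speed at most \<open>\<parallel>v\<parallel> / a\<close> for each
  \<open>a < \<beta> (c t)\<close>, and the radial integral grows with at most \<open>\<beta> (c t)\<close> times that, because its
  integrand at \<open>r\<close> is bounded by \<open>\<beta> (c t)\<close>.  The factors \<open>\<beta> (c t)\<close> cancel up to \<open>k > 1\<close>.
\<close>

lemma lift_radial_bound:
  assumes c: "continuous_on {0..\<tau>} c" "\<And>t. t \<in> {0..\<tau>} \<Longrightarrow> f (c t) = y + t *\<^sub>R v" and "0 \<le> \<tau>"
  shows "radial_integral (rate (c 0)) (norm (c \<tau> - c 0)) \<le> ennreal (norm v * \<tau>)"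
proof -
  define x0 where "x0 = c 0"
  define G where "G r = enn2real (radial_integral (rate x0) r)" for r
  have fin: "radial_integral (rate x0) r < \<infinity>" for r
    by (rule radial_integral_finite[OF antimono_rate rate_0_le])
  have G_incr: "G r' \<le> G r + \<beta> x * (r' - r)" if "r \<le> r'" "norm (x - x0) = r" for r r' x
    unfolding G_def using that \<beta>_pos[of x]
    by (intro radial_integral_real_increment[OF antimono_rate rate_0_le] rate_le) auto
  have G_incr0: "G r' \<le> G r + \<beta> x0 * (r' - r)" if "0 \<le> r" "r \<le> r'" for r r'
    unfolding G_def using that \<beta>_pos[of x0] 
    by (intro radial_integral_real_increment[OF antimono_rate rate_0_le] order_trans[OF antimonoD[OF antimono_rate] rate_0_le]) auto
  have G_mono: "G r \<le> G r'" if "r \<le> r'" for r r'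
    unfolding G_def using fin[of r'] that by (intro enn2real_mono radial_integral_mono) auto
  have "(\<beta> x0)-lipschitz_on {0..} G"
  proof (rule lipschitz_on_leI)
    fix r r' :: real assume "r \<in> {0..}" "r' \<in> {0..}" "r \<le> r'"
    then show "dist (G r) (G r') \<le> \<beta> x0 * dist r r'"
      using G_incr0[of r r'] G_mono[of r r'] by (simp add: dist_real_def)
  qed (use \<beta>_pos[of x0] in simp)
  then have contG: "continuous_on {0..} G" by (rule lipschitz_on_continuous_on)
  have "G (norm (c \<tau> - x0)) \<le> norm v * \<tau> + e" if "0 < e" for e
  proof -
    \<comment> \<open>chosen such that \<open>\<parallel>v\<parallel> \<tau> k \<le> \<parallel>v\<parallel> \<tau> + e\<close>; the summand 1 avoids a division by zero\<close>
    define k where "k = 1 + e / (norm v * \<tau> + 1)"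
    have nn: "0 \<le> norm v * \<tau>" using \<open>0 \<le> \<tau>\<close> by simp
    then have k: "1 < k" using \<open>0 < e\<close> by (simp add: k_def)
    have "G (norm (c \<tau> - x0)) \<le> G (norm (c 0 - x0)) + norm v * k * (\<tau> - 0)"
    proof (rule dini_mean_value[OF \<open>0 \<le> \<tau>\<close>])
      show "continuous_on {0..\<tau>} (\<lambda>t. G (norm (c t - x0)))"
        by (rule continuous_on_compose2[OF contG]) (auto intro!: continuous_intros c(1))
      fix t assume t: "0 \<le> t" "t < \<tau>"
      define b where "b = \<beta> (c t)"
      have b: "0 < b" using \<beta>_pos by (simp add: b_def)
      have "b / k < b" using b k by (simp add: field_simps)
      then have "eventually (\<lambda>h. norm (c (t + h) - c t) \<le> norm v / (b / k) * h) (at_right 0)"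
        using t b k by (intro lift_speed[OF c]) (auto simp: b_def)
      moreover have "eventually (\<lambda>h::real. 0 < h) (at_right 0)" by (rule eventually_at_right_less)
      ultimately show "eventually (\<lambda>h. G (norm (c (t + h) - x0)) \<le> G (norm (c t - x0)) + norm v * k * h) (at_right 0)"
      proof eventually_elim
        case (elim h)
        define s where "s = norm v / (b / k) * h"
        have "0 \<le> s" using elim b k by (simp add: s_def)
        have "norm (c (t + h) - x0) \<le> norm (c t - x0) + s"
          using elim norm_triangle_ineq[of "c (t + h) - c t" "c t - x0"] by (simp add: s_def)
        then have "G (norm (c (t + h) - x0)) \<le> G (norm (c t - x0) + s)" by (rule G_mono)
        also have "\<dots> \<le> G (norm (c t - x0)) + b * s"
          using G_incr[of "norm (c t - x0)" "norm (c t - x0) + s" "c t"] \<open>0 \<le> s\<close> by (simp add: b_def)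
        also have "b * s = norm v * k * h" using b by (simp add: s_def)
        finally show ?case .
      qed
    qed
    also have "G (norm (c 0 - x0)) = 0" by (simp add: x0_def G_def radial_integral_0)
    also have "0 + norm v * k * (\<tau> - 0) = norm v * \<tau> + e * ((norm v * \<tau>) / (norm v * \<tau> + 1))"
      by (simp add: k_def algebra_simps)
    also have "\<dots> \<le> norm v * \<tau> + e * 1"
      using nn \<open>0 < e\<close> by (intro add_left_mono mult_left_mono) (auto simp: divide_le_eq_1)
    finally show ?thesis by simp
  qed
  then have "G (norm (c \<tau> - x0)) \<le> norm v * \<tau>" by (rule field_le_epsilon)
  then have "ennreal (G (norm (c \<tau> - x0))) \<le> ennreal (norm v * \<tau>)" by (rule ennreal_leI)
  then show ?thesis using fin by (simp add: G_def x0_def)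
qed

text \<open>
  By compactness one radius \<open>\<eta>\<close> of expansion serves along all of \<open>c\<close>.  A curve \<open>c'\<close> that starts with
  \<open>c\<close> and has a nearby image cannot leave the tube of radius \<open>\<eta>\<close> about \<open>c\<close>: inside the tube the
  expansion estimate gives distance at most \<open>\<eta> / 2\<close>, so the set of times spent in the tube is both open and closed.
  The lemma yields the uniqueness of lifts as well as their continuous dependence on the segment.
\<close>

lemma lift_stability:
  fixes c :: "real \<Rightarrow> 'a"
  assumes I: "compact I" "connected I" "t0 \<in> I" and c: "continuous_on I c"
    and a: "0 < a" "\<forall>t\<in>I. a < \<beta> (c t)"
  shows "\<exists>d>0. \<forall>c'. continuous_on I c' \<longrightarrow> c' t0 = c t0 \<longrightarrow>
      (\<forall>t\<in>I. dist (f (c t)) (f (c' t)) < d) \<longrightarrow>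
      (\<forall>t\<in>I. a * dist (c t) (c' t) \<le> dist (f (c t)) (f (c' t)))"
proof -
  define \<G> where "\<G> = {G. open G \<and> (\<forall>u\<in>G. \<forall>w\<in>G. a * dist u w \<le> dist (f u) (f w))}"
  have "c ` I \<subseteq> \<Union>\<G>"
  proof
    fix x assume "x \<in> c ` I"
    then have "a < \<beta> x" using a(2) by blast
    then obtain r where "0 < r" "\<forall>u\<in>ball x r. \<forall>w\<in>ball x r. a * dist u w \<le> dist (f u) (f w)"
      using expands by blast
    then have "ball x r \<in> \<G>" "x \<in> ball x r" by (auto simp: \<G>_def)
    then show "x \<in> \<Union>\<G>" by blast
  qed
  moreover have "compact (c ` I)" using c I(1) by (rule compact_continuous_image)
  moreover have "open G" if "G \<in> \<G>" for G using that by (simp add: \<G>_def)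
  ultimately obtain \<eta> where \<eta>: "0 < \<eta>" "\<And>x. x \<in> c ` I \<Longrightarrow> \<exists>G\<in>\<G>. ball x \<eta> \<subseteq> G"
    using Heine_Borel_lemma by blast
  have exp: "a * dist (c t) w \<le> dist (f (c t)) (f w)" if tI: "t \<in> I" and w: "dist (c t) w < \<eta>" for t w
  proof -
    obtain G where "G \<in> \<G>" "ball (c t) \<eta> \<subseteq> G" using \<eta>(2) tI by blast
    moreover have "c t \<in> ball (c t) \<eta>" "w \<in> ball (c t) \<eta>" using w \<eta>(1) by auto
    ultimately show ?thesis unfolding \<G>_def by blast
  qed
  show ?thesis
  proof (intro exI[of _ "a * \<eta> / 2"] conjI allI impI ballI)
    show "0 < a * \<eta> / 2" using a \<eta> by simp
    fix c' t
    assume c': "continuous_on I c'" "c' t0 = c t0"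
      and close: "\<forall>t\<in>I. dist (f (c t)) (f (c' t)) < a * \<eta> / 2" and "t \<in> I"
    define S where "S = {t \<in> I. dist (c t) (c' t) < \<eta>}"
    have half: "dist (c t) (c' t) \<le> \<eta> / 2" if "t \<in> S" for t
    proof -
      have "a * dist (c t) (c' t) \<le> a * (\<eta> / 2)"
        using exp[of t "c' t"] bspec[OF close, of t] that by (simp add: S_def)
      then show ?thesis using a(1) by simp
    qed
    then have S2: "S = {t \<in> I. dist (c t) (c' t) \<le> \<eta> / 2}"
      using \<eta>(1) by (fastforce simp: S_def)
    have "continuous_on I (\<lambda>t. dist (c t) (c' t))" by (intro continuous_intros c c'(1))
    then have "openin (top_of_set I) (I \<inter> (\<lambda>t. dist (c t) (c' t)) -` {..<\<eta>})"
      "closedin (top_of_set I) (I \<inter> (\<lambda>t. dist (c t) (c' t)) -` {..\<eta> / 2})"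
      by (auto intro!: continuous_openin_preimage_gen continuous_closedin_preimage)
    moreover have "I \<inter> (\<lambda>t. dist (c t) (c' t)) -` {..<\<eta>} = S" by (auto simp: S_def)
    moreover have "I \<inter> (\<lambda>t. dist (c t) (c' t)) -` {..\<eta> / 2} = S" by (auto simp: S2)
    ultimately have "openin (top_of_set I) S" "closedin (top_of_set I) S" by simp_all
    then have "S = {} \<or> S = I" using I(2) unfolding connected_clopen by blast
    moreover have "t0 \<in> S" using I(3) c'(2) \<eta>(1) by (simp add: S_def)
    ultimately have "S = I" by blast
    then show "a * dist (c t) (c' t) \<le> dist (f (c t)) (f (c' t))"
      using \<open>t \<in> I\<close> by (intro exp) (auto simp: S_def)
  qed
qed

end

section \<open>Lifting segments and the global inverse\<close>

locale hadamard_expanding = locally_expanding +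
  fixes x0
  assumes divergent: "(\<integral>\<^sup>+t\<in>{0..}. rate x0 t \<partial>lborel) = \<infinity>"
begin

text \<open>
  Segments are parametrised by their velocity \<open>v\<close> and followed up to time \<open>\<tau>\<close>, so that partial lifts
  of one segment are comparable by restriction.
\<close>

definition lift :: "'b \<Rightarrow> real \<Rightarrow> (real \<Rightarrow> 'a) \<Rightarrow> bool" where
  "lift v \<tau> c \<longleftrightarrow> continuous_on {0..\<tau>} c \<and> c 0 = x0 \<and> (\<forall>t\<in>{0..\<tau>}. f (c t) = f x0 + t *\<^sub>R v)"

lemma liftD:
  assumes "lift v \<tau> c"
  shows "continuous_on {0..\<tau>} c" "c 0 = x0" "t \<in> {0..\<tau>} \<Longrightarrow> f (c t) = f x0 + t *\<^sub>R v"
  using assms by (auto simp: lift_def)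

lemma lift_restrict: "lift v \<tau> c \<Longrightarrow> \<sigma> \<le> \<tau> \<Longrightarrow> lift v \<sigma> c"
  by (auto simp: lift_def intro: continuous_on_subset)

lemma lift_const: "lift 0 \<tau> (\<lambda>_. x0)"
  by (simp add: lift_def)

text \<open>
  The radial bound confines all lifts of segments of length at most \<open>L\<close> to a ball of radius \<open>n\<close> whose radial
  integral exceeds \<open>L\<close>; any positive number below the rate of that ball will do.
\<close>

lemma lift_rate_lower_bound:
  "\<exists>a>0. \<forall>v \<tau> c. norm v \<le> L \<longrightarrow> \<tau> \<le> 1 \<longrightarrow> lift v \<tau> c \<longrightarrow> (\<forall>t\<in>{0..\<tau>}. a < \<beta> (c t))"
proof -
  obtain n :: nat where n: "ennreal L < radial_integral (rate x0) (real n)"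
    using radial_integral_unbounded[OF antimono_rate rate_0_le divergent] by blast
  have "0 < rate x0 (real n)"
    by (rule rate_pos_of_divergent[OF antimono_rate rate_0_le divergent])
  then obtain a' where a': "0 < a'" "a' < rate x0 (real n)" using dense by blast
  then obtain a where a: "a' = ennreal a" "0 < a"
    by (cases a') (auto simp: ennreal_less_zero_iff)
  show ?thesis
  proof (intro exI[of _ a] conjI allI impI ballI)
    show "0 < a" by fact
    fix v \<tau> c t
    assume v: "norm v \<le> L" and \<tau>: "\<tau> \<le> 1" "lift v \<tau> c" and t: "t \<in> {0..\<tau>}"
    then have l: "lift v t c" by (intro lift_restrict[OF \<tau>(2)]) auto
    have "radial_integral (rate x0) (norm (c t - x0)) \<le> ennreal (norm v * t)"
      using lift_radial_bound[OF liftD(1,3)[OF l]] t by (simp add: liftD(2)[OF l])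
    also have "\<dots> \<le> ennreal L"
      using v t \<tau>(1) mult_left_le[of t "norm v"] by (intro ennreal_leI) auto
    also have "\<dots> < radial_integral (rate x0) (real n)" by fact
    finally have "norm (c t - x0) \<le> real n"
      using radial_integral_mono[of "real n" "norm (c t - x0)"] by (meson leD le_cases)
    then have "rate x0 (real n) \<le> ennreal (\<beta> (c t))" by (rule rate_le)
    with a' a have "ennreal a < ennreal (\<beta> (c t))" by simp
    then show "a < \<beta> (c t)" using a(2) by (simp add: ennreal_less_iff)
  qed
qed

lemma lift_unique:
  assumes "\<tau> \<le> 1" "lift v \<tau> c" "lift v \<tau> c'" "t \<in> {0..\<tau>}"
  shows "c' t = c t"
proof -
  obtain a where a: "0 < a" and good:
    "\<forall>w \<tau> c. norm w \<le> norm v \<longrightarrow> \<tau> \<le> 1 \<longrightarrow> lift w \<tau> c \<longrightarrow> (\<forall>t\<in>{0..\<tau>}. a < \<beta> (c t))"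
    using lift_rate_lower_bound[of "norm v"] by (elim exE conjE) (rule that)
  have good': "\<forall>t\<in>{0..\<tau>}. a < \<beta> (c t)"
    by (intro ballI) (rule good[rule_format, OF order_refl assms(1,2)])
  have "0 \<in> {0..\<tau>}" using assms(4) by auto
  from lift_stability[OF compact_Icc connected_Icc this liftD(1)[OF assms(2)] \<open>0 < a\<close> good']
  obtain d where "0 < d" and d:
    "\<forall>c'. continuous_on {0..\<tau>} c' \<longrightarrow> c' 0 = c 0 \<longrightarrow>
      (\<forall>t\<in>{0..\<tau>}. dist (f (c t)) (f (c' t)) < d) \<longrightarrow>
      (\<forall>t\<in>{0..\<tau>}. a * dist (c t) (c' t) \<le> dist (f (c t)) (f (c' t)))"
    by (elim exE conjE) (rule that)
  have "dist (f (c t)) (f (c' t)) = 0" if "t \<in> {0..\<tau>}" for t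
    using liftD(3)[OF assms(2) that] liftD(3)[OF assms(3) that] by simp
  then have "a * dist (c t) (c' t) \<le> dist (f (c t)) (f (c' t))"
    using liftD(2)[OF assms(2)] liftD(2)[OF assms(3)] \<open>0 < d\<close> assms(4)
    by (intro d[rule_format, OF liftD(1)[OF assms(3)]]) simp_all
  then show ?thesis
    using a(1) assms by (simp add: lift_def mult_le_0_iff)
qed

lemma lift_extend:
  assumes C: "lift v \<tau> c" and "0 \<le> \<tau>"
  obtains e where "0 < e" "\<forall>t. \<tau> \<le> t \<longrightarrow> t < \<tau> + e \<longrightarrow> (\<exists>c'. lift v t c')"
proof -
  obtain r g where rg: "0 < r" "open (f ` ball (c \<tau>) r)" "continuous_on (f ` ball (c \<tau>) r) g"
    "\<forall>u\<in>ball (c \<tau>) r. g (f u) = u"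
    by (rule local_inverse[of "c \<tau>"])
  define \<gamma> where "\<gamma> t = f x0 + t *\<^sub>R v" for t
  have \<tau>: "f (c \<tau>) = \<gamma> \<tau>" using liftD(3)[OF C] \<open>0 \<le> \<tau>\<close> by (simp add: \<gamma>_def)
  have "open (\<gamma> -` (f ` ball (c \<tau>) r))"
    unfolding \<gamma>_def by (intro open_vimage rg continuous_intros)
  moreover have "\<tau> \<in> \<gamma> -` (f ` ball (c \<tau>) r)" using rg(1) by (simp flip: \<tau>)
  ultimately obtain e where e: "0 < e" "ball \<tau> e \<subseteq> \<gamma> -` (f ` ball (c \<tau>) r)"
    using openE by blast
  show ?thesis
  proof (rule that[of e], fact, intro allI impI)
    fix t assume t: "\<tau> \<le> t" "t < \<tau> + e"
    have near: "\<gamma> u \<in> f ` ball (c \<tau>) r" if "\<tau> \<le> u" "u \<le> t" for u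
      using e(2) that t by (auto simp: dist_real_def subset_iff)
    define c' where "c' u = (if u \<le> \<tau> then c u else g (\<gamma> u))" for u
    have "continuous_on {0..t} c'"
      unfolding c'_def
    proof (rule continuous_on_cases_le)
      show "continuous_on {u \<in> {0..t}. u \<le> \<tau>} c"
        by (rule continuous_on_subset[OF liftD(1)[OF C]]) auto
      show "continuous_on {u \<in> {0..t}. \<tau> \<le> u} (\<lambda>u. g (\<gamma> u))"
        by (rule continuous_on_compose2[OF rg(3)])
          (use near in \<open>auto simp: \<gamma>_def intro!: continuous_intros\<close>)
      show "c u = g (\<gamma> u)" if "u = \<tau>" for u
        using rg(1) rg(4)[rule_format, of "c \<tau>"] that by (simp flip: \<tau>)
    qed (intro continuous_intros)
    moreover have "f (c' u) = \<gamma> u" if u: "u \<in> {0..t}" for u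
    proof (cases "u \<le> \<tau>")
      case True
      then show ?thesis using liftD(3)[OF C] that by (simp add: c'_def \<gamma>_def)
    next
      case False
      then obtain z where "z \<in> ball (c \<tau>) r" "\<gamma> u = f z" using near[of u] u by auto
      then show ?thesis using False rg(4) by (simp add: c'_def)
    qed
    ultimately have "lift v t c'"
      using liftD(2)[OF C] \<open>0 \<le> \<tau>\<close> by (simp add: lift_def c'_def \<gamma>_def)
    then show "\<exists>c'. lift v t c'" by blast
  qed
qed

text \<open>
  The set \<open>S\<close> of times up to which the segment lifts is open in \<open>[0, 1]\<close> by the local inverses.  It is closed because,
  by uniqueness, all partial lifts fit together to one curve \<open>C\<close> on \<open>S\<close>, which is Lipschitz and hence
  extends continuously to the closure of \<open>S\<close> by completeness.
\<close>

lemma lift_exists: "\<exists>c. lift v 1 c"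
proof -
  define S where "S = {\<tau> \<in> {0..1}. \<exists>c. lift v \<tau> c}"
  define C where "C t = (SOME c. lift v t c) t" for t
  have down: "s \<in> S" if "t \<in> S" "0 \<le> s" "s \<le> t" for s t
    using that lift_restrict[of v t _ s] by (auto simp: S_def)
  have liftC: "lift v \<tau> C" if \<tau>S: "\<tau> \<in> S" for \<tau>
  proof -
    obtain c where c: "lift v \<tau> c" using \<tau>S by (auto simp: S_def)
    have eq: "C t = c t" if t: "t \<in> {0..\<tau>}" for t
    proof -
      have "lift v t c" using t by (intro lift_restrict[OF c]) simp
      moreover from this have "lift v t (SOME c. lift v t c)" by (rule someI[of "lift v t"])
      moreover have "t \<le> 1" "t \<in> {0..t}" using t \<tau>S by (auto simp: S_def)
      ultimately show ?thesis
        unfolding C_def by (intro lift_unique[where t = t and \<tau> = t])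
    qed
    have "continuous_on {0..\<tau>} C"
      using eq liftD(1)[OF c] by (simp cong: continuous_on_cong_simp)
    then show ?thesis using c eq \<tau>S by (auto simp: lift_def S_def)
  qed
  have "lift v 0 (\<lambda>_. x0)" by (simp add: lift_def)
  then have "0 \<in> S" by (auto simp: S_def)
  obtain a where a: "0 < a" and good:
    "\<forall>w \<tau> c. norm w \<le> norm v \<longrightarrow> \<tau> \<le> 1 \<longrightarrow> lift w \<tau> c \<longrightarrow> (\<forall>t\<in>{0..\<tau>}. a < \<beta> (c t))"
    using lift_rate_lower_bound[of "norm v"] by (elim exE conjE) (rule that)
  have a_C: "a < \<beta> (C t)" if "\<tau> \<in> S" "t \<in> {0..\<tau>}" for \<tau> t
    using \<open>0 < a\<close> good[rule_format, OF order_refl _ liftC[OF that(1)] that(2)] that(1) by (auto simp: S_def)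
  have "(norm v / a)-lipschitz_on S C"
  proof (rule lipschitz_on_leI)
    fix s t assume st: "s \<in> S" "t \<in> S" "s \<le> t"
    then have "norm (C t - C s) \<le> norm v / a * (t - s)"
      using st a_C[OF st(2)] \<open>0 < a\<close>
      by (intro lift_lipschitz[OF liftD(1,3)[OF liftC[OF st(2)] ]]) (auto simp: S_def)
    then show "dist (C s) (C t) \<le> norm v / a * dist s t"
      using st(3) by (simp add: dist_norm norm_minus_commute)
  qed (use \<open>0 < a\<close> in simp)
  then obtain g where g: "uniformly_continuous_on (closure S) g" "\<And>t. t \<in> S \<Longrightarrow> C t = g t"
    using uniformly_continuous_on_extension_on_closure[OF lipschitz_on_uniformly_continuous] by metis
  then have contg: "continuous_on (closure S) g" by (simp add: uniformly_continuous_imp_continuous)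
  have S01: "closure S \<subseteq> {0..1}" by (intro closure_minimal) (auto simp: S_def)
  have fg: "f (g t) - (f x0 + t *\<^sub>R v) = 0" if "t \<in> closure S" for t
  proof (rule continuous_constant_on_closure[OF _ _ that])
    show "continuous_on (closure S) (\<lambda>t. f (g t) - (f x0 + t *\<^sub>R v))"
      by (intro continuous_intros continuous_on_compose2[OF cont contg]) auto
    show "f (g t) - (f x0 + t *\<^sub>R v) = 0" if "t \<in> S" for t
      using liftD(3)[OF liftC[OF that], of t] g(2)[OF that] that by (simp add: S_def)
  qed
  have "closure S \<subseteq> S"
  proof
    fix \<tau> assume \<tau>: "\<tau> \<in> closure S"
    have sub: "{0..\<tau>} \<subseteq> closure S"
    proof
      fix t assume t: "t \<in> {0..\<tau>}"
      show "t \<in> closure S"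
      proof (cases "t = \<tau>")
        case False
        then have "0 < \<tau> - t" using t by simp
        then obtain s where "s \<in> S" "dist s \<tau> < \<tau> - t" using \<tau> closure_approachable by blast
        then have "t \<in> S" using t by (intro down[of s t]) (auto simp: dist_real_def)
        then show ?thesis using closure_subset by blast
      qed (use \<tau> in simp)
    qed
    have "lift v \<tau> g"
      unfolding lift_def
    proof (intro conjI ballI)
      show "continuous_on {0..\<tau>} g" using contg sub by (rule continuous_on_subset)
      show "g 0 = x0" using g(2)[OF \<open>0 \<in> S\<close>] liftD(2)[OF liftC[OF \<open>0 \<in> S\<close>]] by simp
      show "f (g t) = f x0 + t *\<^sub>R v" if "t \<in> {0..\<tau>}" for t
        using fg[of t] sub that by auto
    qed
    then show "\<tau> \<in> S" using \<tau> S01 by (auto simp: S_def)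
  qed
  then have "closed S" by (simp add: closure_subset_eq)
  have "openin (top_of_set {0..1}) S"
    unfolding openin_euclidean_subtopology_iff
  proof (intro conjI ballI)
    show "S \<subseteq> {0..1}" by (auto simp: S_def)
    fix \<tau> assume \<tau>: "\<tau> \<in> S"
    then have "0 \<le> \<tau>" by (simp add: S_def)
    obtain e where e: "0 < e" "\<forall>t. \<tau> \<le> t \<longrightarrow> t < \<tau> + e \<longrightarrow> (\<exists>c'. lift v t c')"
      by (rule lift_extend[OF liftC[OF \<tau>] \<open>0 \<le> \<tau>\<close>])
    have "t \<in> S" if "t \<in> {0..1}" "dist t \<tau> < e" for t
    proof (cases "t \<le> \<tau>")
      case True
      then show ?thesis using down[OF \<tau>] that by simp
    next
      case False
      then show ?thesis using e(2)[rule_format, of t] that by (auto simp: S_def dist_real_def)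
    qed
    then show "\<exists>e>0. \<forall>t\<in>{0..1}. dist t \<tau> < e \<longrightarrow> t \<in> S" using e(1) by blast
  qed
  moreover have "closedin (top_of_set {0..1}) S"
    using \<open>closed S\<close> by (intro closed_subset) (auto simp: S_def)
  ultimately have "S = {} \<or> S = {0..1}"
    using connected_Icc[of "0::real" 1] unfolding connected_clopen by blast
  then have "1 \<in> S" using \<open>0 \<in> S\<close> by auto
  then show ?thesis by (auto simp: S_def)
qed

definition lift_endpoint :: "'b \<Rightarrow> 'a" where
  "lift_endpoint y = (SOME c. lift (y - f x0) 1 c) 1"

lemma lift_endpoint_eq:
  assumes "lift (y - f x0) 1 c"
  shows "lift_endpoint y = c 1"
proof -
  have "lift (y - f x0) 1 (SOME c. lift (y - f x0) 1 c)"
    using assms by (rule someI[of "lift (y - f x0) 1"])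
  from lift_unique[OF order_refl assms this, of 1] show ?thesis by (simp add: lift_endpoint_def)
qed

lemma f_lift_endpoint: "f (lift_endpoint y) = y"
proof -
  obtain c where c: "lift (y - f x0) 1 c" using lift_exists by blast
  then show ?thesis using liftD(3)[OF c, of 1] lift_endpoint_eq by simp
qed

lemma lift_endpoint_base: "lift_endpoint (f x0) = x0"
  using lift_endpoint_eq[of "f x0" "\<lambda>_. x0"] lift_const[of 1] by simp

lemma isCont_lift_endpoint: "isCont lift_endpoint y"
proof -
  obtain c where c: "lift (y - f x0) 1 c" using lift_exists by blast
  obtain a where a: "0 < a" and good:
    "\<forall>w \<tau> c. norm w \<le> norm (y - f x0) \<longrightarrow> \<tau> \<le> 1 \<longrightarrow> lift w \<tau> c \<longrightarrow> (\<forall>t\<in>{0..\<tau>}. a < \<beta> (c t))"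
    using lift_rate_lower_bound[of "norm (y - f x0)"] by (elim exE conjE) (rule that)
  have good': "\<forall>t\<in>{0..1}. a < \<beta> (c t)"
    by (intro ballI) (rule good[rule_format, OF order_refl order_refl c])
  have "(0::real) \<in> {0..1}" by simp
  from lift_stability[OF compact_Icc connected_Icc this liftD(1)[OF c] \<open>0 < a\<close> good']
  obtain d where d: "0 < d"
    "\<forall>c'. continuous_on {0..1} c' \<longrightarrow> c' 0 = c 0 \<longrightarrow>
      (\<forall>t\<in>{0..1}. dist (f (c t)) (f (c' t)) < d) \<longrightarrow>
      (\<forall>t\<in>{0..1}. a * dist (c t) (c' t) \<le> dist (f (c t)) (f (c' t)))"
    by (elim exE conjE) (rule that)
  have near: "a * dist (lift_endpoint y) (lift_endpoint y') \<le> dist y y'" if y': "dist y y' < d" for y'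
  proof -
    obtain c' where c': "lift (y' - f x0) 1 c'" using lift_exists by blast
    have "dist (f (c t)) (f (c' t)) < d" if t: "t \<in> {0..1}" for t
    proof -
      have "f (c t) - f (c' t) = t *\<^sub>R (y - y')"
        unfolding liftD(3)[OF c t] liftD(3)[OF c' t] by (simp add: algebra_simps)
      then have "dist (f (c t)) (f (c' t)) = t * dist y y'" using t by (simp add: dist_norm)
      also have "\<dots> \<le> dist y y'" using t by (simp add: mult_left_le_one_le)
      finally show ?thesis using y' by simp
    qed
    then have "a * dist (c 1) (c' 1) \<le> dist (f (c 1)) (f (c' 1))"
      using liftD(2)[OF c] liftD(2)[OF c']
      by (intro d(2)[rule_format, OF liftD(1)[OF c']]) auto
    then show ?thesis
      using liftD(3)[OF c, of 1] liftD(3)[OF c', of 1] by (simp add: lift_endpoint_eq[OF c] lift_endpoint_eq[OF c'])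
  qed
  show ?thesis
    unfolding continuous_at_eps_delta
  proof (intro allI impI)
    fix e :: real assume "0 < e"
    have "dist (lift_endpoint y') (lift_endpoint y) < e" if "dist y' y < min d (a * e)" for y'
    proof -
      have "a * dist (lift_endpoint y) (lift_endpoint y') < a * e"
        using near[of y'] that by (simp add: dist_commute)
      then show ?thesis using a(1) by (simp add: dist_commute)
    qed
    then show "\<exists>d>0. \<forall>x'. dist x' y < d \<longrightarrow> dist (lift_endpoint x') (lift_endpoint y) < e"
      using d(1) a(1) \<open>0 < e\<close> by (intro exI[of _ "min d (a * e)"]) auto
  qed
qed

text \<open>
  The points \<open>x\<close> with \<open>lift_endpoint (f x) = x\<close> form a closed set by continuity.  They form an open
  set because for \<open>u\<close> near such an \<open>x\<close> both \<open>u\<close> and \<open>lift_endpoint (f u)\<close> lie in a ball on which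
  \<open>f\<close> is injective and have the same image.  Since the domain is connected, all points are of this kind.
\<close>

lemma lift_endpoint_f: "lift_endpoint (f x) = x"
proof -
  have conts: "continuous_on UNIV lift_endpoint"
    using isCont_lift_endpoint continuous_at_imp_continuous_on by blast
  have contsf: "continuous_on UNIV (\<lambda>x. lift_endpoint (f x))"
    by (rule continuous_on_compose2[OF conts cont]) auto
  define E where "E = {x. lift_endpoint (f x) = x}"
  have "closed E"
    unfolding E_def by (intro closed_Collect_eq contsf continuous_intros)
  moreover have "open E"
  proof (subst open_subopen, intro ballI)
    fix x assume x: "x \<in> E"
    obtain r where r: "0 < r" "inj_on f (ball x r)" by (rule locally_injective)
    define U where "U = ball x r \<inter> (\<lambda>x. lift_endpoint (f x)) -` ball x r"
    have "open U" unfolding U_def by (intro open_Int open_vimage contsf open_ball)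
    moreover have "x \<in> U" using x r(1) by (simp add: U_def E_def)
    moreover have "U \<subseteq> E"
    proof
      fix u assume "u \<in> U"
      then have "lift_endpoint (f u) \<in> ball x r" "u \<in> ball x r" by (auto simp: U_def)
      then show "u \<in> E" using inj_onD[OF r(2), of "lift_endpoint (f u)" u] f_lift_endpoint by (simp add: E_def)
    qed
    ultimately show "\<exists>T. open T \<and> x \<in> T \<and> T \<subseteq> E" by blast
  qed
  moreover have "x0 \<in> E" by (simp add: E_def lift_endpoint_base)
  ultimately have "E = UNIV" using clopen[of E] by auto
  then show ?thesis by (auto simp: E_def)
qed

lemma continuous_on_lift_endpoint: "continuous_on A lift_endpoint"
  using isCont_lift_endpoint continuous_at_imp_continuous_on by blast

lemma homeomorphism_lift_endpoint: "homeomorphism UNIV UNIV f lift_endpoint"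
  by (intro homeomorphismI cont continuous_on_lift_endpoint lift_endpoint_f f_lift_endpoint) auto

text \<open>
  A ball of the codomain is convex, and the inverse maps its segments to lifts that stay where the
  expansion factor is at least \<open>a\<close>.
\<close>

lemma lift_endpoint_lipschitz_on_bounded:
  assumes "bounded B"
  shows "\<exists>L. L-lipschitz_on B lift_endpoint"
proof -
  obtain L where L: "B \<subseteq> cball (f x0) L"
    using assms bounded_any_center[of B "f x0"] by (auto simp: subset_iff)
  obtain a where a: "0 < a"
    "\<forall>w \<tau> c. norm w \<le> L \<longrightarrow> \<tau> \<le> 1 \<longrightarrow> lift w \<tau> c \<longrightarrow> (\<forall>t\<in>{0..\<tau>}. a < \<beta> (c t))"
    using lift_rate_lower_bound[of "L"] by (elim exE conjE) (rule that)
  have rate: "a < \<beta> (lift_endpoint y)" if "y \<in> cball (f x0) L" for y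
  proof -
    obtain c where c: "lift (y - f x0) 1 c" using lift_exists by blast
    have "norm (y - f x0) \<le> L" using that by (simp add: dist_norm norm_minus_commute)
    from a(2)[rule_format, OF this order_refl c, of 1] show ?thesis using lift_endpoint_eq[OF c] by simp
  qed
  have "(1 / a)-lipschitz_on B lift_endpoint"
  proof (rule lipschitz_onI)
    fix y y' assume "y \<in> B" "y' \<in> B"
    then have yy: "y \<in> cball (f x0) L" "y' \<in> cball (f x0) L" using L by auto
    define c where "c t = lift_endpoint (y + t *\<^sub>R (y' - y))" for t
    have in_ball: "y + t *\<^sub>R (y' - y) \<in> cball (f x0) L" if "t \<in> {0..1}" for t
      using convexD_alt[OF convex_cball yy, of t] that by (simp add: algebra_simps)
    have "norm (c 1 - c 0) \<le> norm (y' - y) / a * (1 - 0)"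
    proof (rule lift_lipschitz[of 1 c y "y' - y"])
      show "continuous_on {0..1} c"
        unfolding c_def by (rule continuous_on_compose2[OF continuous_on_lift_endpoint[of UNIV]]) (auto intro!: continuous_intros)
      show "f (c t) = y + t *\<^sub>R (y' - y)" for t by (simp add: c_def f_lift_endpoint)
      show "a < \<beta> (c t)" if "t \<in> {0..1}" for t
        unfolding c_def by (intro rate in_ball that)
    qed (use a in auto)
    then show "dist (lift_endpoint y) (lift_endpoint y') \<le> 1 / a * dist y y'"
      by (simp add: c_def dist_norm norm_minus_commute)
  qed (use a in simp)
  then show ?thesis by blast
qed

text \<open>
  The inverse image of a segment starting at \<open>f x1\<close> is a lift starting at \<open>x1\<close>, so the radial bound
  holds about every centre \<open>x1\<close>, although divergence is assumed for \<open>x0\<close> only.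
\<close>

lemma ext_ball_subset_image:
  "ext_ball (f x1) (radial_integral (rate x1) \<delta>) \<subseteq> f ` ball x1 \<delta>"
proof
  fix y assume y: "y \<in> ext_ball (f x1) (radial_integral (rate x1) \<delta>)"
  define c where "c t = lift_endpoint (f x1 + t *\<^sub>R (y - f x1))" for t
  have c0: "c 0 = x1" by (simp add: c_def lift_endpoint_f)
  have "radial_integral (rate (c 0)) (norm (c 1 - c 0)) \<le> ennreal (norm (y - f x1) * 1)"
  proof (rule lift_radial_bound)
    show "continuous_on {0..1} c"
      unfolding c_def by (rule continuous_on_compose2[OF continuous_on_lift_endpoint[of UNIV]]) (auto intro!: continuous_intros)
    show "f (c t) = f x1 + t *\<^sub>R (y - f x1)" for t by (simp add: c_def f_lift_endpoint)
  qed simp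
  also have "\<dots> < radial_integral (rate x1) \<delta>"
    using y by (simp add: ext_ball_def dist_norm norm_minus_commute)
  finally have "norm (c 1 - x1) < \<delta>"
    using radial_integral_mono[of \<delta> "norm (c 1 - x1)" "rate x1"] unfolding c0
    by (metis leD leI)
  then show "y \<in> f ` ball x1 \<delta>"
    by (intro image_eqI[of _ _ "c 1"]) (auto simp: c_def f_lift_endpoint dist_norm norm_minus_commute)
qed

end

section \<open>From the regularity index to the global inverse\<close>

lemma co_norm_lower_bound:
  assumes "ennreal a \<le> co_norm T" "0 \<le> a"
  shows "a * norm w \<le> norm (blinfun_apply T w)"
proof (cases "w = 0")
  case False
  have "co_norm T \<le> ennreal (norm (blinfun_apply T ((1 / norm w) *\<^sub>R w)))"
    unfolding co_norm_def using False by (intro INF_lower) simp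
  with assms(1) have "ennreal a \<le> ennreal (norm (blinfun_apply T ((1 / norm w) *\<^sub>R w)))"
    by (rule order_trans)
  then have "a \<le> norm (blinfun_apply T ((1 / norm w) *\<^sub>R w))"
    by simp
  also have "\<dots> = norm (blinfun_apply T w) / norm w"
    by (simp add: blinfun.scaleR_right)
  finally show ?thesis using False by (simp add: field_simps)
qed simp

lemma regularity_index_uniform_bound:
  assumes "ennreal a < regularity_index UNIV Jf x" "0 \<le> a"
  obtains r where "0 < r"
    "\<And>T w. T \<in> convex hull (\<Union>z\<in>ball x r. Jf z) \<Longrightarrow> a * norm w \<le> norm (blinfun_apply T w)"
proof -
  obtain r where r: "0 < r" "ennreal a < (INF T\<in>convex hull (\<Union>z\<in>ball x r. Jf z). co_norm T)"
    using assms(1) unfolding regularity_index_def by (auto simp: less_SUP_iff)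
  have "a * norm w \<le> norm (blinfun_apply T w)" if "T \<in> convex hull (\<Union>z\<in>ball x r. Jf z)" for T w
  proof (rule co_norm_lower_bound[OF _ assms(2)])
    show "ennreal a \<le> co_norm T" using r(2) INF_lower[OF that, of co_norm] by simp
  qed
  with r(1) show ?thesis using that by blast
qed

text \<open>
  In a nonzero space the index is finite, because each \<open>T \<in> Jf x\<close> belongs to the hull for every radius.
\<close>

lemma regularity_index_le:
  assumes "T \<in> Jf x" "norm e = 1"
  shows "regularity_index UNIV Jf x \<le> ennreal (norm (blinfun_apply T e))"
  unfolding regularity_index_def
proof (rule SUP_least)
  fix r assume "r \<in> {r. 0 < r \<and> ball x r \<subseteq> UNIV}"
  then have "T \<in> convex hull (\<Union>z\<in>ball x r. Jf z)"
    using assms(1) by (intro hull_inc) auto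
  then have "(INF T\<in>convex hull (\<Union>z\<in>ball x r. Jf z). co_norm T) \<le> co_norm T"
    by (rule INF_lower)
  also have "\<dots> \<le> ennreal (norm (blinfun_apply T e))"
    unfolding co_norm_def using assms(2) by (intro INF_lower) simp
  finally show "(INF T\<in>convex hull (\<Union>z\<in>ball x r. Jf z). co_norm T) \<le> ennreal (norm (blinfun_apply T e))" .
qed

lemma regular_at_surj:
  assumes "regular_at UNIV Jf x" "T \<in> convex hull (Jf x)"
  shows "surj (blinfun_apply T)"
proof -
  obtain r where r: "0 < r" "\<forall>T\<in>convex hull (\<Union>z\<in>ball x r. Jf z). is_isomorphism T"
    using assms(1) by (auto simp: regular_at_def)
  have "convex hull (Jf x) \<subseteq> convex hull (\<Union>z\<in>ball x r. Jf z)"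
    using r(1) by (intro hull_mono UN_upper) simp
  then show ?thesis using r(2) assms(2) by (auto simp: is_isomorphism_def bij_def)
qed

text \<open>
  Surjectivity of the operators is taken from regularity at each point \<open>z\<close> near \<open>x\<close>, the
  uniform lower bound \<open>a\<close> from regularity at \<open>x\<close>.
\<close>

lemma regular_imp_open_image:
  fixes f :: "'a::banach \<Rightarrow> 'b::banach"
  assumes cont: "continuous_on UNIV f" and chain: "chain_rule_condition UNIV f Jf"
    and reg: "\<And>x. regular_at UNIV Jf x" and "open U"
  shows "open (f ` U)"
  unfolding open_contains_ball
proof
  fix y assume "y \<in> f ` U"
  then obtain x where x: "x \<in> U" "y = f x" by blast
  have "0 < regularity_index UNIV Jf x" using reg[of x] by (simp add: regular_at_def)
  then obtain a' where a': "0 < a'" "a' < regularity_index UNIV Jf x" using dense by blast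
  then obtain a where a: "a' = ennreal a" "0 < a"
    by (cases a') (auto simp: ennreal_less_zero_iff)
  obtain r where r: "0 < r"
    "\<And>T w. T \<in> convex hull (\<Union>z\<in>ball x r. Jf z) \<Longrightarrow> a * norm w \<le> norm (blinfun_apply T w)"
    using regularity_index_uniform_bound[of a Jf x] a a' by (metis less_imp_le)
  obtain d where d: "0 < d" "ball x d \<subseteq> U" using \<open>open U\<close> x(1) openE by blast
  define \<delta> where "\<delta> = min d r"
  \<comment> \<open>any descent rate strictly below \<open>a\<close> serves here\<close>
  have "ball (f x) (a / 2 * \<delta>) \<subseteq> f ` ball x \<delta>"
  proof (rule descent_implies_open_covering)
    show "continuous_on (cball x \<delta>) f" using cont by (rule continuous_on_subset) simp
    show "0 < \<delta>" using d r by (simp add: \<delta>_def)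
    fix y z assume z: "z \<in> ball x \<delta>" and y: "y \<noteq> f z"
    have sub: "convex hull (Jf z) \<subseteq> convex hull (\<Union>z\<in>ball x r. Jf z)"
      using z by (intro hull_mono UN_upper) (simp add: \<delta>_def)
    obtain w where "norm w = 1" "upper_dini (dist_fun y \<circ> f) z w \<le> ereal (- (a / 2))"
    proof (rule descent_direction[OF chain UNIV_I y, where a = a and s = "a / 2"])
      show "surj (blinfun_apply T)" if "T \<in> convex hull (Jf z)" for T
        using reg that by (rule regular_at_surj)
      show "a * norm w \<le> norm (blinfun_apply T w)" if "T \<in> convex hull (Jf z)" for T w
        using r(2) sub that by blast
    qed (use a(2) in auto)
    then show "\<exists>w. norm w = 1 \<and> upper_dini (dist_fun y \<circ> f) z w \<le> ereal (- (a / 2))" by blast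
  qed
  also have "\<dots> \<subseteq> f ` U" using d(2) by (auto simp: \<delta>_def)
  finally show "\<exists>e>0. ball y e \<subseteq> f ` U"
    using a(2) d(1) r(1) by (intro exI[of _ "a / 2 * \<delta>"]) (auto simp: x(2) \<delta>_def)
qed

lemma regular_imp_locally_expanding:
  fixes f :: "'a::banach \<Rightarrow> 'b::banach"
  assumes cont: "continuous_on UNIV f" and pj: "pseudo_jacobian_mapping UNIV f Jf"
    and chain: "chain_rule_condition UNIV f Jf" and reg: "\<And>x. regular_at UNIV Jf x"
    and fin: "\<And>x. regularity_index UNIV Jf x < \<infinity>"
  shows "locally_expanding f (\<lambda>x. enn2real (regularity_index UNIV Jf x))"
proof
  fix x
  show "0 < enn2real (regularity_index UNIV Jf x)"
    using reg[of x] fin[of x] by (simp add: regular_at_def enn2real_positive_iff)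
  fix a :: real assume a: "a < enn2real (regularity_index UNIV Jf x)"
  \<comment> \<open>the index only controls nonnegative factors; for negative \<open>a\<close> the claim is weaker than for 0\<close>
  define b where "b = max a 0"
  have "ennreal b < ennreal (enn2real (regularity_index UNIV Jf x))"
    using a \<open>0 < enn2real (regularity_index UNIV Jf x)\<close> by (intro ennreal_lessI) (auto simp: b_def)
  then have "ennreal b < regularity_index UNIV Jf x" using fin[of x] by simp
  then obtain r where r: "0 < r"
    "\<And>T w. T \<in> convex hull (\<Union>z\<in>ball x r. Jf z) \<Longrightarrow> b * norm w \<le> norm (blinfun_apply T w)"
    using regularity_index_uniform_bound[of b Jf x] by (auto simp: b_def)
  have "a * dist u v \<le> dist (f u) (f v)" if "u \<in> ball x r" "v \<in> ball x r" for u v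
  proof -
    have "a * dist u v \<le> b * dist u v" by (intro mult_right_mono) (auto simp: b_def)
    also have "\<dots> = b * norm (u - v)" by (simp add: dist_norm)
    also have "\<dots> \<le> norm (f u - f v)"
    proof (rule pseudo_jacobian_expansion[OF convex_ball that(2,1)])
      show "continuous_on (ball x r) f" using cont by (rule continuous_on_subset) simp
      show "pseudo_jacobian_mapping (ball x r) f Jf" using pj by (simp add: pseudo_jacobian_mapping_def)
    qed (rule r(2))
    finally show ?thesis by (simp add: dist_norm)
  qed
  then show "\<exists>r>0. \<forall>u\<in>ball x r. \<forall>v\<in>ball x r. a * dist u v \<le> dist (f u) (f v)"
    using r(1) by blast
qed (use cont regular_imp_open_image[OF cont chain reg] in auto)

lemma trivial_codomain:
  assumes triv: "\<And>x :: 'a::real_normed_vector. x = 0" and T: "surj (blinfun_apply (T :: 'a \<Rightarrow>\<^sub>L 'b::real_normed_vector))"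
  shows "(y :: 'b) = 0"
proof -
  obtain x where "y = blinfun_apply T x" using T by (metis surjD)
  then show ?thesis using triv[of x] by simp
qed

theorem theorem3p7:
  fixes f :: "'a::banach \<Rightarrow> 'b::banach"
    and Jf :: "'a \<Rightarrow> ('a \<Rightarrow>\<^sub>L 'b) set"
  assumes "continuous_on UNIV f"
    and "pseudo_jacobian_mapping UNIV f Jf"
    and "chain_rule_condition UNIV f Jf"
    and "\<And>x. regular_at UNIV Jf x"
    and "(\<integral>\<^sup>+t\<in>{0..}. (INF x\<in>{x. norm x \<le> t}. regularity_index UNIV Jf x) \<partial>lborel) = \<infinity>"
  shows "homeomorphism UNIV UNIV f (inv f) \<and>
    (\<forall>B. bounded B \<longrightarrow> (\<exists>L. L-lipschitz_on B (inv f))) \<and>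
    (\<forall>x0 \<delta>. 0 < \<delta> \<longrightarrow>
      ext_ball (f x0)
        (\<integral>\<^sup>+t\<in>{0..\<delta>}. (INF x\<in>{x. norm (x - x0) \<le> t}. regularity_index UNIV Jf x) \<partial>lborel)
      \<subseteq> f ` ball x0 \<delta>)"
proof -
  have Jf_ne: "Jf x \<noteq> {}" for x
    using assms(2) by (simp add: pseudo_jacobian_mapping_def is_pseudo_jacobian_def)
  show ?thesis
  \<comment> \<open>in the zero space the regularity index is infinite, but then the codomain is zero as well\<close>
  proof (cases "\<exists>e :: 'a. norm e = 1")
    case False
    have triv: "x = 0" for x :: 'a
    proof (rule ccontr)
      assume "x \<noteq> 0"
      then have "norm ((1 / norm x) *\<^sub>R x) = 1" by simp
      then show False using False by blast
    qed
    obtain T where "T \<in> Jf 0" using Jf_ne by blast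
    then have "surj (blinfun_apply T)"
      using regular_at_surj[OF assms(4), of T 0] by (simp add: hull_inc)
    then have triv': "y = 0" for y :: 'b using trivial_codomain[OF triv] by blast
    have inv: "inv f = (\<lambda>_. 0)" by (rule ext) (rule triv)
    have "homeomorphism UNIV UNIV f (inv f)"
      unfolding inv
    proof (rule homeomorphismI)
      show "0 = x" for x :: 'a by (rule triv[symmetric])
      show "f 0 = y" for y using triv'[of "f 0"] triv'[of y] by simp
    qed (use assms(1) in auto)
    moreover have "0-lipschitz_on B (inv f)" for B
      unfolding inv by (intro lipschitz_onI) auto
    moreover have "y \<in> f ` ball x0 \<delta>" if "0 < \<delta>" for y x0 \<delta>
      using that triv'[of y] triv'[of "f x0"] by (intro image_eqI[of _ _ x0]) auto
    ultimately show ?thesis by blast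
  next
    case True
    then obtain e :: 'a where e: "norm e = 1" by blast
    have fin: "regularity_index UNIV Jf x < \<infinity>" for x
    proof -
      obtain T where "T \<in> Jf x" using Jf_ne by blast
      then have "regularity_index UNIV Jf x \<le> ennreal (norm (blinfun_apply T e))"
        using e by (rule regularity_index_le)
      also have "\<dots> < \<infinity>" by simp
      finally show ?thesis .
    qed
    define \<beta> where "\<beta> x = enn2real (regularity_index UNIV Jf x)" for x
    have \<beta>: "ennreal (\<beta> x) = regularity_index UNIV Jf x" for x
      using fin[of x] by (simp add: \<beta>_def)
    interpret locally_expanding f \<beta>
      unfolding \<beta>_def by (rule regular_imp_locally_expanding[OF assms(1-4) fin])
    have rate: "rate x0 t = (INF x\<in>{x. norm (x - x0) \<le> t}. regularity_index UNIV Jf x)" for x0 t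
      by (simp add: rate_def \<beta>)
    interpret hadamard_expanding f \<beta> 0
      by unfold_locales (use assms(5) in \<open>simp add: rate\<close>)
    have "inv f = lift_endpoint" by (rule inv_equality[OF lift_endpoint_f f_lift_endpoint])
    then show ?thesis
      using homeomorphism_lift_endpoint lift_endpoint_lipschitz_on_bounded ext_ball_subset_image
      by (auto simp: radial_integral_def rate)
  qed
qed

end
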